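(* Let $p$ be a prime, let $\mathbb{k}$ be a commutative ring of characteristic $p$, let $R$ be a commutative $\mathbb{k}$-algebra, let $(R,L)$ be a restricted Lie-Rinehart algebra with anchor $\epsilon$, let $\mathfrak p\subset R$ be a prime ideal and $\mathcal S=R\setminus\mathfrak p$. Equip $(R_{\mathfrak p},L_{\mathfrak p})$, where $L_{\mathfrak p}=R_{\mathfrak p}\otimes_R L$, with its Lie-Rinehart algebra structure obtained by localization. Then the formula $$(s^{-1}x)^{[p]}=s^{-p}x^{[p]}-s^{-p-1}\,\epsilon(x)^{p-1}(s)\,x\qquad (s\in\mathcal S,\ x\in L)$$ gives a well-defined map $L_{\mathfrak p}\to L_{\mathfrak p}$, and with this $p$-th power operation $(R_{\mathfrak p},L_{\mathfrak p})$ is a restricted Lie-Rinehart algebra.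
   Context: Let $\mathbb{k}$ be a commutative ring of prime characteristic $p$; algebras are over $\mathbb{k}$, and Lie algebras are $\mathbb{k}$-Lie algebras. Let $R$ be a commutative $\mathbb{k}$-algebra. A Lie-Rinehart algebra $(R,L)$ is a $\mathbb{k}$-Lie algebra $L$ which is also an $R$-module (inducing the given $\mathbb{k}$-module structure), together with an $R$-linear homomorphism of $\mathbb{k}$-Lie algebras $\epsilon\colon L\to \mathrm{Der}_{\mathbb{k}}(R)$, the anchor, such that $[x,ry]=r[x,y]+\epsilon(x)(r)y$ for $x,y\in L$, $r\in R$. A restricted Lie algebra is a $\mathbb{k}$-Lie algebra $L$ with a map $x\mapsto x^{[p]}$ such that $(ax)^{[p]}=a^px^{[p]}$ for $a\in\mathbb{k}$, $[x^{[p]},y]=\mathrm{ad}(x)^p(y)$, and $(x+y)^{[p]}=x^{[p]}+y^{[p]}+\sum_{i=1}^{p-1}\lambda_i(x,y)$, where $i\lambda_i(x,y)$ is the coefficient of $t^{i-1}$ in $\mathrm{ad}(tx+y)^{p-1}(x)$. A restricted Lie-Rinehart algebra is a Lie-Rinehart algebra $(R,L)$ where $L$ is a restricted Lie algebra, the anchor is restricted, i.e. $\epsilon(x^{[p]})=\epsilon(x)^p$ for $x\in L$, and $$(rx)^{[p]}=r^px^{[p]}+(r\epsilon(x))^{p-1}(r)\,x\qquad (x\in L,\ r\in R),$$ where $(r\epsilon(x))^{p-1}(r)\in R$ is the result of applying the derivation $r\epsilon(x)$ of $R$ to $r$ a total of $p-1$ times. For a Lie-Rinehart algebra $(R,L)$,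 a prime ideal $\mathfrak p$ and $\mathcal S=R\setminus\mathfrak p$, the (known) Lie-Rinehart structure of $(R_{\mathfrak p},L_{\mathfrak p})$ is given, for $r\in R$, $s,t\in\mathcal S$, $x,y\in L$, by $$\epsilon(s^{-1}x)(t^{-1}r)=s^{-1}t^{-1}\epsilon(x)(r)-s^{-1}t^{-2}\epsilon(x)(t)\,r,$$ $$[s^{-1}x,t^{-1}y]=s^{-1}t^{-1}[x,y]+s^{-1}\epsilon(x)(t^{-1})\,y-t^{-1}\epsilon(y)(s^{-1})\,x,$$ where $\epsilon(x)(t^{-1})=-t^{-2}\epsilon(x)(t)$. *)

theory Defs
  imports
    "HOL-Algebra.Module"
    "HOL-Algebra.Ideal"
    "HOL-Algebra.Free_Abelian_Groups"
    "HOL-Computational_Algebra.Primes"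
begin

section \<open>Lie algebras over a commutative ring\<close>

definition has_characteristic :: "('k, 'c) ring_scheme \<Rightarrow> nat \<Rightarrow> bool" where
  "has_characteristic K p \<longleftrightarrow> (\<forall>n::nat. [n] \<cdot>\<^bsub>K\<^esub> \<one>\<^bsub>K\<^esub> = \<zero>\<^bsub>K\<^esub> \<longleftrightarrow> p dvd n)"

locale lie_algebra = module K M
  for K :: "('k, 'c) ring_scheme" and M :: "('k, 'l, 'e) module_scheme" +
  fixes br :: "'l \<Rightarrow> 'l \<Rightarrow> 'l"
  assumes br_closed:
      "\<lbrakk>x \<in> carrier M; y \<in> carrier M\<rbrakk> \<Longrightarrow> br x y \<in> carrier M"
    and br_add_left:
      "\<lbrakk>x \<in> carrier M; y \<in> carrier M; z \<in> carrier M\<rbrakk> \<Longrightarrow>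
       br (x \<oplus>\<^bsub>M\<^esub> y) z = br x z \<oplus>\<^bsub>M\<^esub> br y z"
    and br_add_right:
      "\<lbrakk>x \<in> carrier M; y \<in> carrier M; z \<in> carrier M\<rbrakk> \<Longrightarrow>
       br x (y \<oplus>\<^bsub>M\<^esub> z) = br x y \<oplus>\<^bsub>M\<^esub> br x z"
    and br_smult_left:
      "\<lbrakk>c \<in> carrier K; x \<in> carrier M; y \<in> carrier M\<rbrakk> \<Longrightarrow>
       br (c \<odot>\<^bsub>M\<^esub> x) y = c \<odot>\<^bsub>M\<^esub> br x y"
    and br_smult_right:
      "\<lbrakk>c \<in> carrier K; x \<in> carrier M; y \<in> carrier M\<rbrakk> \<Longrightarrow>
       br x (c \<odot>\<^bsub>M\<^esub> y) = c \<odot>\<^bsub>M\<^esub> br x y"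
    and br_self:
      "x \<in> carrier M \<Longrightarrow> br x x = \<zero>\<^bsub>M\<^esub>"
    and jacobi:
      "\<lbrakk>x \<in> carrier M; y \<in> carrier M; z \<in> carrier M\<rbrakk> \<Longrightarrow>
       br x (br y z) \<oplus>\<^bsub>M\<^esub> br y (br z x) \<oplus>\<^bsub>M\<^esub> br z (br x y) = \<zero>\<^bsub>M\<^esub>"

text \<open>
  An element of the Lie algebra \<open>M[t]\<close> of polynomials with coefficients in \<open>M\<close> is given by its
  coefficient sequence; \<open>poly_bracket\<close> is the extension of the bracket, bilinear over polynomials in \<open>t\<close>, to \<open>M[t]\<close>.
  Thus \<open>jacobson_coeff M br p x y n\<close> is the coefficient of \<open>t^n\<close> in \<open>ad(tx+y)^(p-1)(x)\<close>.
\<close>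

definition poly_bracket ::
  "('k, 'l, 'e) module_scheme \<Rightarrow> ('l \<Rightarrow> 'l \<Rightarrow> 'l) \<Rightarrow> (nat \<Rightarrow> 'l) \<Rightarrow> (nat \<Rightarrow> 'l) \<Rightarrow> (nat \<Rightarrow> 'l)" where
  "poly_bracket M br f g = (\<lambda>n. \<Oplus>\<^bsub>M\<^esub>i\<in>{..n}. br (f i) (g (n - i)))"

definition jacobson_coeff ::
  "('k, 'l, 'e) module_scheme \<Rightarrow> ('l \<Rightarrow> 'l \<Rightarrow> 'l) \<Rightarrow> nat \<Rightarrow> 'l \<Rightarrow> 'l \<Rightarrow> nat \<Rightarrow> 'l" where
  "jacobson_coeff M br p x y =
     (poly_bracket M br (\<lambda>n. if n = 0 then y else if n = 1 then x else \<zero>\<^bsub>M\<^esub>) ^^ (p - 1))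
       (\<lambda>n. if n = 0 then x else \<zero>\<^bsub>M\<^esub>)"

text \<open>
  The element \<open>\<lambda>\<^sub>i(x,y)\<close>.  The description is proper for \<open>0 < i < p\<close>, because \<open>i\<close> is then
  invertible in a ring of characteristic \<open>p\<close>.
\<close>

definition jacobson ::
  "('k, 'l, 'e) module_scheme \<Rightarrow> ('l \<Rightarrow> 'l \<Rightarrow> 'l) \<Rightarrow> nat \<Rightarrow> nat \<Rightarrow> 'l \<Rightarrow> 'l \<Rightarrow> 'l" where
  "jacobson M br p i x y =
     (THE z. z \<in> carrier M \<and> [i] \<cdot>\<^bsub>M\<^esub> z = jacobson_coeff M br p x y (i - 1))"

locale restricted_lie_algebra = lie_algebra K M br
  for K :: "('k, 'c) ring_scheme" and M :: "('k, 'l, 'e) module_scheme"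
    and br :: "'l \<Rightarrow> 'l \<Rightarrow> 'l" +
  fixes p :: nat and P :: "'l \<Rightarrow> 'l"
  assumes prime_p: "prime p"
    and char_p: "has_characteristic K p"
    and P_closed: "x \<in> carrier M \<Longrightarrow> P x \<in> carrier M"
    and P_smult:
      "\<lbrakk>a \<in> carrier K; x \<in> carrier M\<rbrakk> \<Longrightarrow> P (a \<odot>\<^bsub>M\<^esub> x) = (a [^]\<^bsub>K\<^esub> p) \<odot>\<^bsub>M\<^esub> P x"
    and br_P:
      "\<lbrakk>x \<in> carrier M; y \<in> carrier M\<rbrakk> \<Longrightarrow> br (P x) y = (br x ^^ p) y"
    and P_add:
      "\<lbrakk>x \<in> carrier M; y \<in> carrier M\<rbrakk> \<Longrightarrow>
       P (x \<oplus>\<^bsub>M\<^esub> y) = P x \<oplus>\<^bsub>M\<^esub> P y \<oplus>\<^bsub>M\<^esub> (\<Oplus>\<^bsub>M\<^esub>i\<in>{1..p - 1}. jacobson M br p i x y)"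


section \<open>Lie-Rinehart algebras\<close>

definition derivations :: "('k, 'c) ring_scheme \<Rightarrow> ('k, 'r, 'd) module_scheme \<Rightarrow> ('r \<Rightarrow> 'r) set" where
  "derivations K R = {D. D \<in> carrier R \<rightarrow> carrier R \<and>
     (\<forall>a\<in>carrier R. \<forall>b\<in>carrier R. D (a \<oplus>\<^bsub>R\<^esub> b) = D a \<oplus>\<^bsub>R\<^esub> D b) \<and>
     (\<forall>c\<in>carrier K. \<forall>a\<in>carrier R. D (c \<odot>\<^bsub>R\<^esub> a) = c \<odot>\<^bsub>R\<^esub> D a) \<and>
     (\<forall>a\<in>carrier R. \<forall>b\<in>carrier R. D (a \<otimes>\<^bsub>R\<^esub> b) = a \<otimes>\<^bsub>R\<^esub> D b \<oplus>\<^bsub>R\<^esub> D a \<otimes>\<^bsub>R\<^esub> b)}"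

text \<open>The \<open>K\<close>-module underlying an \<open>R\<close>-module \<open>L\<close>, where \<open>R\<close> is a \<open>K\<close>-algebra.\<close>

definition restrict_scalars ::
  "('k, 'r, 'd) module_scheme \<Rightarrow> ('r, 'l, 'e) module_scheme \<Rightarrow> ('k, 'l) module" where
  "restrict_scalars R L =
     \<lparr>carrier = carrier L, monoid.mult = monoid.mult L, one = one L, ring.zero = ring.zero L, add = add L,
      smult = (\<lambda>c x. (c \<odot>\<^bsub>R\<^esub> \<one>\<^bsub>R\<^esub>) \<odot>\<^bsub>L\<^esub> x)\<rparr>"

locale lie_rinehart =
  R: algebra K R + L: module R L + Lie: lie_algebra K "restrict_scalars R L" br
  for K :: "('k, 'c) ring_scheme" and R :: "('k, 'r, 'd) module_scheme"
    and L :: "('r, 'l, 'e) module_scheme" and br :: "'l \<Rightarrow> 'l \<Rightarrow> 'l" +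
  fixes anc :: "'l \<Rightarrow> 'r \<Rightarrow> 'r"
  assumes anc_derivation:
      "x \<in> carrier L \<Longrightarrow> anc x \<in> derivations K R"
    and anc_add:
      "\<lbrakk>x \<in> carrier L; y \<in> carrier L; a \<in> carrier R\<rbrakk> \<Longrightarrow>
       anc (x \<oplus>\<^bsub>L\<^esub> y) a = anc x a \<oplus>\<^bsub>R\<^esub> anc y a"
    and anc_smult:
      "\<lbrakk>r \<in> carrier R; x \<in> carrier L; a \<in> carrier R\<rbrakk> \<Longrightarrow>
       anc (r \<odot>\<^bsub>L\<^esub> x) a = r \<otimes>\<^bsub>R\<^esub> anc x a"
    and anc_br:
      "\<lbrakk>x \<in> carrier L; y \<in> carrier L; a \<in> carrier R\<rbrakk> \<Longrightarrow>
       anc (br x y) a = anc x (anc y a) \<ominus>\<^bsub>R\<^esub> anc y (anc x a)"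
    and br_leibniz:
      "\<lbrakk>x \<in> carrier L; y \<in> carrier L; r \<in> carrier R\<rbrakk> \<Longrightarrow>
       br x (r \<odot>\<^bsub>L\<^esub> y) = r \<odot>\<^bsub>L\<^esub> br x y \<oplus>\<^bsub>L\<^esub> anc x r \<odot>\<^bsub>L\<^esub> y"

locale restricted_lie_rinehart =
  lie_rinehart K R L br anc + Lie: restricted_lie_algebra K "restrict_scalars R L" br p P
  for K :: "('k, 'c) ring_scheme" and R :: "('k, 'r, 'd) module_scheme"
    and L :: "('r, 'l, 'e) module_scheme" and br :: "'l \<Rightarrow> 'l \<Rightarrow> 'l"
    and anc :: "'l \<Rightarrow> 'r \<Rightarrow> 'r" and p :: nat and P :: "'l \<Rightarrow> 'l" +
  assumes anc_P:
      "\<lbrakk>x \<in> carrier L; a \<in> carrier R\<rbrakk> \<Longrightarrow> anc (P x) a = (anc x ^^ p) a"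
    and P_smult_R:
      "\<lbrakk>r \<in> carrier R; x \<in> carrier L\<rbrakk> \<Longrightarrow>
       P (r \<odot>\<^bsub>L\<^esub> x) =
         (r [^]\<^bsub>R\<^esub> p) \<odot>\<^bsub>L\<^esub> P x \<oplus>\<^bsub>L\<^esub> ((\<lambda>a. r \<otimes>\<^bsub>R\<^esub> anc x a) ^^ (p - 1)) r \<odot>\<^bsub>L\<^esub> x"


section \<open>Localization of rings\<close>

text \<open>\<open>frac R S r s\<close> is the fraction \<open>r/s\<close>, as a class of pairs, for a multiplicative set \<open>S\<close>.\<close>

definition frac :: "('r, 'd) ring_scheme \<Rightarrow> 'r set \<Rightarrow> 'r \<Rightarrow> 'r \<Rightarrow> ('r \<times> 'r) set" where
  "frac R S r s = {(r', s'). r' \<in> carrier R \<and> s' \<in> S \<and>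
     (\<exists>u\<in>S. u \<otimes>\<^bsub>R\<^esub> (s' \<otimes>\<^bsub>R\<^esub> r) = u \<otimes>\<^bsub>R\<^esub> (s \<otimes>\<^bsub>R\<^esub> r'))}"

abbreviation embed :: "('r, 'd) ring_scheme \<Rightarrow> 'r set \<Rightarrow> 'r \<Rightarrow> ('r \<times> 'r) set" where
  "embed R S r \<equiv> frac R S r \<one>\<^bsub>R\<^esub>"

abbreviation recip :: "('r, 'd) ring_scheme \<Rightarrow> 'r set \<Rightarrow> 'r \<Rightarrow> ('r \<times> 'r) set" where
  "recip R S s \<equiv> frac R S \<one>\<^bsub>R\<^esub> s"

definition localization ::
  "('k, 'r, 'd) module_scheme \<Rightarrow> 'r set \<Rightarrow> ('k, ('r \<times> 'r) set) module" where
  "localization R S =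
     \<lparr>carrier = {frac R S r s |r s. r \<in> carrier R \<and> s \<in> S},
      monoid.mult = (\<lambda>A B. \<Union>(r, s)\<in>A. \<Union>(r', s')\<in>B. frac R S (r \<otimes>\<^bsub>R\<^esub> r') (s \<otimes>\<^bsub>R\<^esub> s')),
      one = frac R S \<one>\<^bsub>R\<^esub> \<one>\<^bsub>R\<^esub>,
      ring.zero = frac R S \<zero>\<^bsub>R\<^esub> \<one>\<^bsub>R\<^esub>,
      add = (\<lambda>A B. \<Union>(r, s)\<in>A. \<Union>(r', s')\<in>B.
               frac R S (s' \<otimes>\<^bsub>R\<^esub> r \<oplus>\<^bsub>R\<^esub> s \<otimes>\<^bsub>R\<^esub> r') (s \<otimes>\<^bsub>R\<^esub> s')),
      smult = (\<lambda>c A. \<Union>(r, s)\<in>A. frac R S (c \<odot>\<^bsub>R\<^esub> r) s)\<rparr>"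


section \<open>Extension of scalars\<close>

text \<open>
  The tensor product \<open>A \<otimes>\<^sub>R N\<close> of an \<open>R\<close>-algebra \<open>A\<close>, with structure map \<open>\<phi>\<close>, and an \<open>R\<close>-module
  \<open>N\<close>, as an \<open>A\<close>-module: the free abelian group on the pairs \<open>(a, x)\<close> modulo the subgroup generated
  by the biadditivity and \<open>R\<close>-balancedness relations.  The ring multiplication and unit of the
  record are irrelevant for a module.
\<close>

definition tensor_relations ::
  "('r, 'd) ring_scheme \<Rightarrow> ('a, 'b) ring_scheme \<Rightarrow> ('r \<Rightarrow> 'a) \<Rightarrow> ('r, 'l, 'e) module_scheme \<Rightarrow>
   ('a \<times> 'l \<Rightarrow>\<^sub>0 int) set" where
  "tensor_relations R A \<phi> N =
     {frag_of (a \<oplus>\<^bsub>A\<^esub> b, x) - frag_of (a, x) - frag_of (b, x) |a b x.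
        a \<in> carrier A \<and> b \<in> carrier A \<and> x \<in> carrier N} \<union>
     {frag_of (a, x \<oplus>\<^bsub>N\<^esub> y) - frag_of (a, x) - frag_of (a, y) |a x y.
        a \<in> carrier A \<and> x \<in> carrier N \<and> y \<in> carrier N} \<union>
     {frag_of (\<phi> r \<otimes>\<^bsub>A\<^esub> a, x) - frag_of (a, r \<odot>\<^bsub>N\<^esub> x) |r a x.
        r \<in> carrier R \<and> a \<in> carrier A \<and> x \<in> carrier N}"

definition tensor_null ::
  "('r, 'd) ring_scheme \<Rightarrow> ('a, 'b) ring_scheme \<Rightarrow> ('r \<Rightarrow> 'a) \<Rightarrow> ('r, 'l, 'e) module_scheme \<Rightarrow>
   ('a \<times> 'l \<Rightarrow>\<^sub>0 int) set" where
  "tensor_null R A \<phi> N =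
     generate (free_Abelian_group (carrier A \<times> carrier N)) (tensor_relations R A \<phi> N)"

definition tensor_class ::
  "('r, 'd) ring_scheme \<Rightarrow> ('a, 'b) ring_scheme \<Rightarrow> ('r \<Rightarrow> 'a) \<Rightarrow> ('r, 'l, 'e) module_scheme \<Rightarrow>
   ('a \<times> 'l \<Rightarrow>\<^sub>0 int) \<Rightarrow> ('a \<times> 'l \<Rightarrow>\<^sub>0 int) set" where
  "tensor_class R A \<phi> N f =
     tensor_null R A \<phi> N #>\<^bsub>free_Abelian_group (carrier A \<times> carrier N)\<^esub> f"

definition extend_scalars ::
  "('r, 'd) ring_scheme \<Rightarrow> ('a, 'b) ring_scheme \<Rightarrow> ('r \<Rightarrow> 'a) \<Rightarrow> ('r, 'l, 'e) module_scheme \<Rightarrow>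
   ('a, ('a \<times> 'l \<Rightarrow>\<^sub>0 int) set) module" where
  "extend_scalars R A \<phi> N =
     \<lparr>carrier = carrier (free_Abelian_group (carrier A \<times> carrier N) Mod tensor_null R A \<phi> N),
      monoid.mult = undefined,
      one = undefined,
      ring.zero = \<one>\<^bsub>free_Abelian_group (carrier A \<times> carrier N) Mod tensor_null R A \<phi> N\<^esub>,
      add = (\<lambda>X Y. X \<otimes>\<^bsub>free_Abelian_group (carrier A \<times> carrier N) Mod tensor_null R A \<phi> N\<^esub> Y),
      smult = (\<lambda>a X. \<Union>f\<in>X. tensor_class R A \<phi> N
                 (frag_extend (\<lambda>(b, x). frag_of (a \<otimes>\<^bsub>A\<^esub> b, x)) f))\<rparr>"


section \<open>Localization of Lie-Rinehart algebras\<close>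

definition module_localization ::
  "('k, 'r, 'd) module_scheme \<Rightarrow> 'r set \<Rightarrow> ('r, 'l, 'e) module_scheme \<Rightarrow>
   (('r \<times> 'r) set, (('r \<times> 'r) set \<times> 'l \<Rightarrow>\<^sub>0 int) set) module" where
  "module_localization R S L =
     extend_scalars R (localization R S) (embed R S) L"

text \<open>\<open>mfrac R S L a x\<close> is \<open>a \<otimes> x\<close>, written \<open>a x\<close> in the text, for \<open>a\<close> in the localized ring.\<close>

definition mfrac ::
  "('k, 'r, 'd) module_scheme \<Rightarrow> 'r set \<Rightarrow> ('r, 'l, 'e) module_scheme \<Rightarrow>
   ('r \<times> 'r) set \<Rightarrow> 'l \<Rightarrow> (('r \<times> 'r) set \<times> 'l \<Rightarrow>\<^sub>0 int) set" where
  "mfrac R S L a x =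
     tensor_class R (localization R S) (embed R S) L (frag_of (a, x))"

text \<open>
  The structure maps are given by formulas on fractions; the descriptions are proper because
  every element of the localized module is of the form \<open>s\<^sup>-\<^sup>1 x\<close> (lemma \<open>T_cases\<close> below) and the
  formulas do not depend on the choice of the fractions (lemmas \<open>local_anchor_eq\<close> and
  \<open>local_bracket_eq\<close>).
\<close>

definition local_anchor ::
  "('k, 'r, 'd) module_scheme \<Rightarrow> 'r set \<Rightarrow> ('r, 'l, 'e) module_scheme \<Rightarrow> ('l \<Rightarrow> 'r \<Rightarrow> 'r) \<Rightarrow>
   (('r \<times> 'r) set \<times> 'l \<Rightarrow>\<^sub>0 int) set \<Rightarrow> ('r \<times> 'r) set \<Rightarrow> ('r \<times> 'r) set" where
  "local_anchor R S L anc X A =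
     (let Q = localization R S in
      THE B. \<exists>s\<in>S. \<exists>t\<in>S. \<exists>x\<in>carrier L. \<exists>r\<in>carrier R.
        X = mfrac R S L (recip R S s) x \<and>
        A = recip R S t \<otimes>\<^bsub>Q\<^esub> embed R S r \<and>
        B = recip R S s \<otimes>\<^bsub>Q\<^esub> recip R S t \<otimes>\<^bsub>Q\<^esub> embed R S (anc x r)
            \<ominus>\<^bsub>Q\<^esub> recip R S s \<otimes>\<^bsub>Q\<^esub> recip R S t [^]\<^bsub>Q\<^esub> (2::nat) \<otimes>\<^bsub>Q\<^esub> embed R S (anc x t)
              \<otimes>\<^bsub>Q\<^esub> embed R S r)"

text \<open>The element \<open>\<epsilon>(x)(t\<^sup>-\<^sup>1)\<close>.\<close>

definition anchor_recip ::
  "('k, 'r, 'd) module_scheme \<Rightarrow> 'r set \<Rightarrow> ('l \<Rightarrow> 'r \<Rightarrow> 'r) \<Rightarrow> 'l \<Rightarrow> 'r \<Rightarrow> ('r \<times> 'r) set" where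
  "anchor_recip R S anc x t =
     (let Q = localization R S in
      \<ominus>\<^bsub>Q\<^esub> (recip R S t [^]\<^bsub>Q\<^esub> (2::nat) \<otimes>\<^bsub>Q\<^esub> embed R S (anc x t)))"

definition local_bracket ::
  "('k, 'r, 'd) module_scheme \<Rightarrow> 'r set \<Rightarrow> ('r, 'l, 'e) module_scheme \<Rightarrow>
   ('l \<Rightarrow> 'l \<Rightarrow> 'l) \<Rightarrow> ('l \<Rightarrow> 'r \<Rightarrow> 'r) \<Rightarrow>
   (('r \<times> 'r) set \<times> 'l \<Rightarrow>\<^sub>0 int) set \<Rightarrow> (('r \<times> 'r) set \<times> 'l \<Rightarrow>\<^sub>0 int) set \<Rightarrow>
   (('r \<times> 'r) set \<times> 'l \<Rightarrow>\<^sub>0 int) set" where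
  "local_bracket R S L br anc X Y =
     (let Q = localization R S; M = module_localization R S L in
      THE Z. \<exists>s\<in>S. \<exists>t\<in>S. \<exists>x\<in>carrier L. \<exists>y\<in>carrier L.
        X = mfrac R S L (recip R S s) x \<and>
        Y = mfrac R S L (recip R S t) y \<and>
        Z = mfrac R S L (recip R S s \<otimes>\<^bsub>Q\<^esub> recip R S t) (br x y)
            \<oplus>\<^bsub>M\<^esub> mfrac R S L (recip R S s \<otimes>\<^bsub>Q\<^esub> anchor_recip R S anc x t) y
            \<ominus>\<^bsub>M\<^esub> mfrac R S L (recip R S t \<otimes>\<^bsub>Q\<^esub> anchor_recip R S anc y s) x)"


section \<open>The structure maps of the localization are well defined\<close>

text \<open>
  \<open>N\<close> is the group of fractions \<open>S\<^sup>-\<^sup>1 L\<close> as classes of pairs; it is used to decide when two elements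
  \<open>s\<^sup>-\<^sup>1 x\<close> of the tensor product \<open>T\<close> coincide.
\<close>

locale localization_setup = R: cring R + L: module R L
  for R :: "('k, 'r, 'd) module_scheme" (structure) and L :: "('r, 'l, 'e) module_scheme" +
  fixes S :: "'r set"
  assumes S_sub: "S \<subseteq> carrier R" and one_S [simp]: "\<one> \<in> S"
    and mult_S [simp]: "\<lbrakk>s \<in> S; t \<in> S\<rbrakk> \<Longrightarrow> s \<otimes> t \<in> S"
begin

lemma S_carr [simp]: "s \<in> S \<Longrightarrow> s \<in> carrier R" using S_sub by auto

definition mf :: "'l \<Rightarrow> 'r \<Rightarrow> ('l \<times> 'r) set" where
  "mf x s = {(x', s'). x' \<in> carrier L \<and> s' \<in> S \<and>
     (\<exists>u\<in>S. u \<odot>\<^bsub>L\<^esub> (s' \<odot>\<^bsub>L\<^esub> x) = u \<odot>\<^bsub>L\<^esub> (s \<odot>\<^bsub>L\<^esub> x'))}"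

lemma mf_trans:
  assumes "x \<in> carrier L" "y \<in> carrier L" "z \<in> carrier L" "s \<in> S" "t \<in> S" "w \<in> S"
    "u \<in> S" "u \<odot>\<^bsub>L\<^esub> (t \<odot>\<^bsub>L\<^esub> x) = u \<odot>\<^bsub>L\<^esub> (s \<odot>\<^bsub>L\<^esub> y)"
    "v \<in> S" "v \<odot>\<^bsub>L\<^esub> (w \<odot>\<^bsub>L\<^esub> y) = v \<odot>\<^bsub>L\<^esub> (t \<odot>\<^bsub>L\<^esub> z)"
  shows "\<exists>q\<in>S. q \<odot>\<^bsub>L\<^esub> (w \<odot>\<^bsub>L\<^esub> x) = q \<odot>\<^bsub>L\<^esub> (s \<odot>\<^bsub>L\<^esub> z)"
proof (rule bexI)
  have "(u \<otimes> v \<otimes> t) \<odot>\<^bsub>L\<^esub> (w \<odot>\<^bsub>L\<^esub> x) = (v \<otimes> w) \<odot>\<^bsub>L\<^esub> (u \<odot>\<^bsub>L\<^esub> (t \<odot>\<^bsub>L\<^esub> x))"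
    using assms(1-7,9) by (simp add: L.smult_assoc1[symmetric] R.m_ac)
  also have "\<dots> = (u \<otimes> s) \<odot>\<^bsub>L\<^esub> (v \<odot>\<^bsub>L\<^esub> (w \<odot>\<^bsub>L\<^esub> y))"
    unfolding assms(8) using assms(1-7,9) by (simp add: L.smult_assoc1[symmetric] R.m_ac)
  also have "\<dots> = (u \<otimes> v \<otimes> t) \<odot>\<^bsub>L\<^esub> (s \<odot>\<^bsub>L\<^esub> z)"
    unfolding assms(10) using assms(1-7,9) by (simp add: L.smult_assoc1[symmetric] R.m_ac)
  finally show "(u \<otimes> v \<otimes> t) \<odot>\<^bsub>L\<^esub> (w \<odot>\<^bsub>L\<^esub> x) = (u \<otimes> v \<otimes> t) \<odot>\<^bsub>L\<^esub> (s \<odot>\<^bsub>L\<^esub> z)" .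
qed (use assms in simp)

lemma mf_self: "\<lbrakk>x \<in> carrier L; s \<in> S\<rbrakk> \<Longrightarrow> (x, s) \<in> mf x s"
  by (auto simp: mf_def)

lemma mf_eq:
  assumes "x \<in> carrier L" "y \<in> carrier L" "s \<in> S" "t \<in> S"
  shows "mf x s = mf y t \<longleftrightarrow> (\<exists>u\<in>S. u \<odot>\<^bsub>L\<^esub> (t \<odot>\<^bsub>L\<^esub> x) = u \<odot>\<^bsub>L\<^esub> (s \<odot>\<^bsub>L\<^esub> y))"
proof
  assume "mf x s = mf y t"
  then have "(y, t) \<in> mf x s" using mf_self assms by simp
  then show "\<exists>u\<in>S. u \<odot>\<^bsub>L\<^esub> (t \<odot>\<^bsub>L\<^esub> x) = u \<odot>\<^bsub>L\<^esub> (s \<odot>\<^bsub>L\<^esub> y)" by (auto simp: mf_def)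
next
  assume "\<exists>u\<in>S. u \<odot>\<^bsub>L\<^esub> (t \<odot>\<^bsub>L\<^esub> x) = u \<odot>\<^bsub>L\<^esub> (s \<odot>\<^bsub>L\<^esub> y)"
  then obtain u where u: "u \<in> S" "u \<odot>\<^bsub>L\<^esub> (t \<odot>\<^bsub>L\<^esub> x) = u \<odot>\<^bsub>L\<^esub> (s \<odot>\<^bsub>L\<^esub> y)" by blast
  show "mf x s = mf y t"
  proof (rule Set.set_eqI, unfold split_paired_all, rule iffI)
    fix z w assume "(z, w) \<in> mf x s"
    then obtain v where v: "z \<in> carrier L" "w \<in> S" "v \<in> S"
      "v \<odot>\<^bsub>L\<^esub> (w \<odot>\<^bsub>L\<^esub> x) = v \<odot>\<^bsub>L\<^esub> (s \<odot>\<^bsub>L\<^esub> z)" by (auto simp: mf_def)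
    show "(z, w) \<in> mf y t"
      using mf_trans[of y x z t s w u v] u(1) u(2)[symmetric] v assms by (auto simp: mf_def)
  next
    fix z w assume "(z, w) \<in> mf y t"
    then obtain v where v: "z \<in> carrier L" "w \<in> S" "v \<in> S"
      "v \<odot>\<^bsub>L\<^esub> (w \<odot>\<^bsub>L\<^esub> y) = v \<odot>\<^bsub>L\<^esub> (t \<odot>\<^bsub>L\<^esub> z)" by (auto simp: mf_def)
    show "(z, w) \<in> mf x s"
      using mf_trans[of x y z s t w u v] u v assms by (auto simp: mf_def)
  qed
qed

lemma mf_memD: "\<lbrakk>(y, t) \<in> mf x s; x \<in> carrier L; s \<in> S\<rbrakk> \<Longrightarrow> y \<in> carrier L \<and> t \<in> S \<and> mf y t = mf x s"
  using mf_eq[of x y s t] by (auto simp: mf_def)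

lemma mf_eqI:
  assumes "x \<in> carrier L" "y \<in> carrier L" "s \<in> S" "t \<in> S" "t \<odot>\<^bsub>L\<^esub> x = s \<odot>\<^bsub>L\<^esub> y"
  shows "mf x s = mf y t"
  using assms one_S by (auto simp: mf_eq)

lemma UN_const: "\<lbrakk>A \<noteq> {}; \<And>a. a \<in> A \<Longrightarrow> f a = c\<rbrakk> \<Longrightarrow> (\<Union>a\<in>A. f a) = c"
  by auto

definition N where
  "N = \<lparr>carrier = {mf x s |x s. x \<in> carrier L \<and> s \<in> S},
        monoid.mult = (\<lambda>A B. \<Union>(x, s)\<in>A. \<Union>(y, t)\<in>B. mf (t \<odot>\<^bsub>L\<^esub> x \<oplus>\<^bsub>L\<^esub> s \<odot>\<^bsub>L\<^esub> y) (s \<otimes> t)),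
        one = mf \<zero>\<^bsub>L\<^esub> \<one>\<rparr>"

lemma mf_add_cong:
  assumes "x \<in> carrier L" "y \<in> carrier L" "s \<in> S" "t \<in> S"
    "x' \<in> carrier L" "y' \<in> carrier L" "s' \<in> S" "t' \<in> S" "mf x s = mf x' s'" "mf y t = mf y' t'"
  shows "mf (t \<odot>\<^bsub>L\<^esub> x \<oplus>\<^bsub>L\<^esub> s \<odot>\<^bsub>L\<^esub> y) (s \<otimes> t) = mf (t' \<odot>\<^bsub>L\<^esub> x' \<oplus>\<^bsub>L\<^esub> s' \<odot>\<^bsub>L\<^esub> y') (s' \<otimes> t')"
proof -
  obtain u where u: "u \<in> S" "u \<odot>\<^bsub>L\<^esub> (s' \<odot>\<^bsub>L\<^esub> x) = u \<odot>\<^bsub>L\<^esub> (s \<odot>\<^bsub>L\<^esub> x')"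
    using assms mf_eq by blast
  obtain v where v: "v \<in> S" "v \<odot>\<^bsub>L\<^esub> (t' \<odot>\<^bsub>L\<^esub> y) = v \<odot>\<^bsub>L\<^esub> (t \<odot>\<^bsub>L\<^esub> y')"
    using assms mf_eq by blast
  note a = assms(1-8) u(1) v(1)
  have "(u \<otimes> v) \<odot>\<^bsub>L\<^esub> ((s' \<otimes> t') \<odot>\<^bsub>L\<^esub> (t \<odot>\<^bsub>L\<^esub> x \<oplus>\<^bsub>L\<^esub> s \<odot>\<^bsub>L\<^esub> y))
      = (v \<otimes> t' \<otimes> t) \<odot>\<^bsub>L\<^esub> (u \<odot>\<^bsub>L\<^esub> (s' \<odot>\<^bsub>L\<^esub> x)) \<oplus>\<^bsub>L\<^esub> (u \<otimes> s \<otimes> s') \<odot>\<^bsub>L\<^esub> (v \<odot>\<^bsub>L\<^esub> (t' \<odot>\<^bsub>L\<^esub> y))"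
    using a by (simp add: L.smult_assoc1[symmetric] L.smult_r_distr R.m_ac)
  also have "\<dots> = (u \<otimes> v) \<odot>\<^bsub>L\<^esub> ((s \<otimes> t) \<odot>\<^bsub>L\<^esub> (t' \<odot>\<^bsub>L\<^esub> x' \<oplus>\<^bsub>L\<^esub> s' \<odot>\<^bsub>L\<^esub> y'))"
    unfolding u(2) v(2) using a by (simp add: L.smult_assoc1[symmetric] L.smult_r_distr R.m_ac)
  finally show ?thesis using a by (subst mf_eq) (auto intro!: bexI[of _ "u \<otimes> v"])
qed

lemma N_mult [simp]:
  assumes "x \<in> carrier L" "y \<in> carrier L" "s \<in> S" "t \<in> S"
  shows "mf x s \<otimes>\<^bsub>N\<^esub> mf y t = mf (t \<odot>\<^bsub>L\<^esub> x \<oplus>\<^bsub>L\<^esub> s \<odot>\<^bsub>L\<^esub> y) (s \<otimes> t)"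
proof -
  have "(\<Union>(x, s)\<in>mf x s. \<Union>(y, t)\<in>mf y t. mf (t \<odot>\<^bsub>L\<^esub> x \<oplus>\<^bsub>L\<^esub> s \<odot>\<^bsub>L\<^esub> y) (s \<otimes> t))
    = mf (t \<odot>\<^bsub>L\<^esub> x \<oplus>\<^bsub>L\<^esub> s \<odot>\<^bsub>L\<^esub> y) (s \<otimes> t)"
    apply (rule UN_const)
    using mf_self[of x s] assms apply auto[1]
    apply clarify
    apply (rule UN_const)
    using mf_self[of y t] assms apply auto[1]
    apply clarify
    apply (drule mf_memD, use assms in simp, use assms in simp)+
    apply (rule mf_add_cong)
    using assms by auto
  then show ?thesis by (simp add: N_def)
qed

lemma N_carr: "carrier N = {mf x s |x s. x \<in> carrier L \<and> s \<in> S}" by (simp add: N_def)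
lemma N_one: "\<one>\<^bsub>N\<^esub> = mf \<zero>\<^bsub>L\<^esub> \<one>" by (simp add: N_def)

lemma N_group: "comm_group N"
proof (rule comm_groupI)
  fix X Y assume "X \<in> carrier N" "Y \<in> carrier N"
  then show "X \<otimes>\<^bsub>N\<^esub> Y \<in> carrier N" by (auto simp: N_carr) (metis L.a_closed L.smult_closed S_carr mult_S)
next
  show "\<one>\<^bsub>N\<^esub> \<in> carrier N" unfolding N_carr N_one using one_S L.M.zero_closed by blast
next
  fix X Y Z assume "X \<in> carrier N" "Y \<in> carrier N" "Z \<in> carrier N"
  then show "X \<otimes>\<^bsub>N\<^esub> Y \<otimes>\<^bsub>N\<^esub> Z = X \<otimes>\<^bsub>N\<^esub> (Y \<otimes>\<^bsub>N\<^esub> Z)"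
    by (auto simp: N_carr L.smult_assoc1[symmetric] L.smult_r_distr R.m_ac L.M.a_ac)
next
  fix X Y assume "X \<in> carrier N" "Y \<in> carrier N"
  then show "X \<otimes>\<^bsub>N\<^esub> Y = Y \<otimes>\<^bsub>N\<^esub> X" by (auto simp: N_carr R.m_ac L.M.a_ac)
next
  fix X assume "X \<in> carrier N"
  then show "\<one>\<^bsub>N\<^esub> \<otimes>\<^bsub>N\<^esub> X = X" by (auto simp: N_carr N_one)
next
  fix X assume "X \<in> carrier N"
  then obtain x s where x: "X = mf x s" "x \<in> carrier L" "s \<in> S" by (auto simp: N_carr)
  have "mf (\<ominus>\<^bsub>L\<^esub> x) s \<otimes>\<^bsub>N\<^esub> X = \<one>\<^bsub>N\<^esub>"
    using x by (simp add: N_one L.smult_r_minus L.M.l_neg) (rule mf_eqI, auto)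
  then show "\<exists>Y\<in>carrier N. Y \<otimes>\<^bsub>N\<^esub> X = \<one>\<^bsub>N\<^esub>" using x by (intro bexI[of _ "mf (\<ominus>\<^bsub>L\<^esub> x) s"]) (auto simp: N_carr)
qed


lemma N_abelian: "abelian_group \<lparr>carrier = carrier N, monoid.mult = m, one = e, ring.zero = \<one>\<^bsub>N\<^esub>, add = monoid.mult N, \<dots> = q\<rparr>"
proof -
  interpret N: comm_group N by (rule N_group)
  show ?thesis
    by (rule abelian_groupI) (auto simp: N.m_ac intro: N.l_inv_ex)
qed
end

definition self_mod where "self_mod R = \<lparr>carrier = carrier R, monoid.mult = undefined, one = undefined,
   ring.zero = ring.zero R, add = add R, smult = monoid.mult R\<rparr>"

lemma (in cring) self_module: "module R (self_mod R)"
proof -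
  have 1: "abelian_group (self_mod R)"
    by (rule abelian_groupI) (simp_all add: self_mod_def a_ac add.l_inv_ex)
  show ?thesis by (rule moduleI[OF cring_axioms 1]) (auto simp: self_mod_def l_distr r_distr m_assoc)
qed

context localization_setup
begin
sublocale F: localization_setup R "self_mod R" S
  by (simp add: localization_setup_def R.cring_axioms R.self_module localization_setup_axioms_def S_sub)

lemma frac_mf: "frac R S r s = F.mf r s"
  unfolding frac_def F.mf_def by (simp add: self_mod_def)

lemma smc [simp]: "carrier (self_mod R) = carrier R" "smult (self_mod R) = monoid.mult R" "add (self_mod R) = add R"
  "ring.zero (self_mod R) = ring.zero R"
  by (simp_all add: self_mod_def)

abbreviation "Q \<equiv> localization R S"

lemma Q_simps: "carrier Q = carrier F.N" "add Q = monoid.mult F.N" "ring.zero Q = one F.N"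
  by (simp_all add: localization_def F.N_def frac_mf)

lemma frac_eq: "\<lbrakk>r \<in> carrier R; r' \<in> carrier R; s \<in> S; t \<in> S\<rbrakk> \<Longrightarrow>
   frac R S r s = frac R S r' t \<longleftrightarrow> (\<exists>u\<in>S. u \<otimes> (t \<otimes> r) = u \<otimes> (s \<otimes> r'))"
  unfolding frac_mf using F.mf_eq[of r r' s t] by simp

lemma frac_eqI: "\<lbrakk>r \<in> carrier R; r' \<in> carrier R; s \<in> S; t \<in> S; t \<otimes> r = s \<otimes> r'\<rbrakk> \<Longrightarrow>
   frac R S r s = frac R S r' t"
  unfolding frac_mf by (rule F.mf_eqI) simp_all

lemma frac_carr [simp]: "\<lbrakk>r \<in> carrier R; s \<in> S\<rbrakk> \<Longrightarrow> frac R S r s \<in> carrier Q"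
  unfolding localization_def by (simp, blast)

lemma frac_cases: assumes "A \<in> carrier Q" obtains r s where "r \<in> carrier R" "s \<in> S" "A = frac R S r s"
  using assms unfolding localization_def by (simp, blast)

lemma frac_add [simp]: "\<lbrakk>r \<in> carrier R; r' \<in> carrier R; s \<in> S; t \<in> S\<rbrakk> \<Longrightarrow>
   frac R S r s \<oplus>\<^bsub>Q\<^esub> frac R S r' t = frac R S (t \<otimes> r \<oplus> s \<otimes> r') (s \<otimes> t)"
  unfolding frac_mf Q_simps(2) using F.N_mult[of r r' s t] by simp

lemma frac_mult [simp]: assumes "r \<in> carrier R" "r' \<in> carrier R" "s \<in> S" "t \<in> S"
  shows "frac R S r s \<otimes>\<^bsub>Q\<^esub> frac R S r' t = frac R S (r \<otimes> r') (s \<otimes> t)"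
proof -
  have 1: "frac R S (a \<otimes> b) (c \<otimes> d) = frac R S (r \<otimes> r') (s \<otimes> t)"
    if h: "(a, c) \<in> frac R S r s" "(b, d) \<in> frac R S r' t" for a b c d
  proof -
    obtain u where u: "u \<in> S" "u \<otimes> (c \<otimes> r) = u \<otimes> (s \<otimes> a)" "a \<in> carrier R" "c \<in> S"
      using h by (auto simp: frac_def)
    obtain v where v: "v \<in> S" "v \<otimes> (d \<otimes> r') = v \<otimes> (t \<otimes> b)" "b \<in> carrier R" "d \<in> S"
      using h by (auto simp: frac_def)
    have "(u \<otimes> v) \<otimes> ((s \<otimes> t) \<otimes> (a \<otimes> b)) = (u \<otimes> (s \<otimes> a)) \<otimes> (v \<otimes> (t \<otimes> b))"
      using assms u(1,3,4) v(1,3,4) by (simp add: R.m_ac)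
    also have "\<dots> = (u \<otimes> v) \<otimes> ((c \<otimes> d) \<otimes> (r \<otimes> r'))"
      unfolding u(2)[symmetric] v(2)[symmetric] using assms u(1,3,4) v(1,3,4) by (simp add: R.m_ac)
    finally show ?thesis using assms u(1,3,4) v(1,3,4) by (subst frac_eq) (auto intro!: bexI[of _ "u \<otimes> v"])
  qed
  have n: "(r, s) \<in> frac R S r s" "(r', t) \<in> frac R S r' t" using assms by (simp_all add: frac_mf F.mf_self)
  have "frac R S r s \<otimes>\<^bsub>Q\<^esub> frac R S r' t =
    (\<Union>(a, c)\<in>frac R S r s. \<Union>(b, d)\<in>frac R S r' t. frac R S (a \<otimes> b) (c \<otimes> d))"
    by (simp add: localization_def)
  also have "\<dots> = frac R S (r \<otimes> r') (s \<otimes> t)"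
    apply (rule UN_const) using n(1) apply blast
    apply clarify apply (rule UN_const) using n(2) apply blast
    apply clarify by (rule 1)
  finally show ?thesis .
qed

lemma Q_one: "\<one>\<^bsub>Q\<^esub> = frac R S \<one> \<one>" and Q_zero: "\<zero>\<^bsub>Q\<^esub> = frac R S \<zero> \<one>"
  by (simp_all add: localization_def)

lemma Q_abelian: "abelian_group Q"
  using F.N_abelian unfolding localization_def F.N_def frac_mf by simp

lemma Q_cring: "cring Q"
proof (rule cringI[OF Q_abelian])
  show "Group.comm_monoid Q"
  proof (rule comm_monoidI)
    show "\<one>\<^bsub>Q\<^esub> \<in> carrier Q" by (simp add: Q_one)
  qed (auto elim!: frac_cases simp: R.m_ac Q_one)
next
  fix x y z assume "x \<in> carrier Q" "y \<in> carrier Q" "z \<in> carrier Q"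
  then show "(x \<oplus>\<^bsub>Q\<^esub> y) \<otimes>\<^bsub>Q\<^esub> z = x \<otimes>\<^bsub>Q\<^esub> z \<oplus>\<^bsub>Q\<^esub> y \<otimes>\<^bsub>Q\<^esub> z"
    apply (elim frac_cases) apply hypsubst apply (simp add: R.m_ac R.l_distr R.r_distr)
    apply (rule frac_eqI) by (auto simp: R.m_ac R.l_distr R.r_distr)
qed

sublocale Q: cring Q by (rule Q_cring)

lemma frac_uminus [simp]:
  assumes "r \<in> carrier R" "s \<in> S" shows "\<ominus>\<^bsub>Q\<^esub> frac R S r s = frac R S (\<ominus> r) s"
proof (rule Q.minus_equality)
  show "frac R S (\<ominus> r) s \<oplus>\<^bsub>Q\<^esub> frac R S r s = \<zero>\<^bsub>Q\<^esub>"
    using assms by (simp add: Q_zero R.r_minus R.l_neg) (rule frac_eqI, auto)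
qed (use assms in auto)

abbreviation "FG \<equiv> free_Abelian_group (carrier Q \<times> carrier L)"
abbreviation "NL \<equiv> tensor_null R Q (embed R S) L"
abbreviation "T \<equiv> module_localization R S L"

lemma keysD: "\<lbrakk>Poly_Mapping.keys f \<subseteq> A; Poly_Mapping.keys g \<subseteq> A\<rbrakk> \<Longrightarrow> Poly_Mapping.keys (f - g :: 'z \<Rightarrow>\<^sub>0 int) \<subseteq> A"
  using keys_diff[of f g] by blast

lemma keys1: "x \<in> A \<Longrightarrow> Poly_Mapping.keys (frag_of x) \<subseteq> A" by simp

lemma rels_sub: "tensor_relations R Q (embed R S) L \<subseteq> carrier FG"
proof
  fix f assume "f \<in> tensor_relations R Q (embed R S) L"
  then show "f \<in> carrier FG"
    unfolding tensor_relations_def carrier_free_Abelian_group_iff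
    apply (elim UnE CollectE exE conjE)
    apply (hypsubst, intro keysD keys1; simp)+
    done
qed

lemma NL_subgroup: "subgroup NL FG"
  unfolding tensor_null_def by (rule group.generate_is_subgroup[OF group_free_Abelian_group rels_sub])

lemma NL_normal: "normal NL FG"
  by (rule comm_group.subgroup_imp_normal[OF abelian_free_Abelian_group NL_subgroup])

abbreviation "tc \<equiv> tensor_class R Q (embed R S) L"

lemma T_group: "comm_group (FG Mod NL)"
  by (rule comm_group.abelian_FactGroup[OF abelian_free_Abelian_group NL_subgroup])

lemma tc_add: "\<lbrakk>f \<in> carrier FG; g \<in> carrier FG\<rbrakk> \<Longrightarrow> tc f \<oplus>\<^bsub>T\<^esub> tc g = tc (f + g)"
  unfolding module_localization_def extend_scalars_def tensor_class_def
  using normal.rcos_sum[OF NL_normal, of f g] by (simp add: FactGroup_def)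

lemma tc_eq: assumes "f \<in> carrier FG" "g \<in> carrier FG" shows "tc f = tc g \<longleftrightarrow> f - g \<in> NL"
proof -
  interpret FG: group FG by (rule group_free_Abelian_group)
  have 1: "tc f = tc g \<longleftrightarrow> f \<in> tc g"
    unfolding tensor_class_def
    using FG.repr_independence[OF _ assms(2) NL_subgroup, of f] FG.rcos_self[OF assms(1) NL_subgroup] by metis
  have 2: "f \<in> tc g \<longleftrightarrow> f \<otimes>\<^bsub>FG\<^esub> inv\<^bsub>FG\<^esub> g \<in> NL"
    unfolding tensor_class_def by (rule subgroup.rcos_module[OF NL_subgroup group_free_Abelian_group assms(2,1)])
  have 3: "inv\<^bsub>FG\<^esub> g = - g" by (rule inv_free_Abelian_group) (use assms in simp)
  show ?thesis unfolding 1 2 3 by simp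
qed

lemma T_carr: "carrier T = tc ` carrier FG"
  by (auto simp: module_localization_def extend_scalars_def tensor_class_def FactGroup_def RCOSETS_def)

lemma T_sel: "carrier T = carrier (FG Mod NL)" "add T = monoid.mult (FG Mod NL)" "ring.zero T = one (FG Mod NL)"
  unfolding module_localization_def extend_scalars_def by (auto intro!: ext)

lemma T_abelian: "abelian_group T"
proof -
  interpret G: comm_group "FG Mod NL" by (rule T_group)
  show ?thesis 
    apply (rule abelian_groupI; unfold T_sel)
    apply (erule (1) G.m_closed)
    apply (rule G.one_closed)
    apply (erule (2) G.m_assoc)
    apply (erule (1) G.m_comm)
    apply (erule G.l_one)
    apply (erule G.l_inv_ex)
    done
qed

sublocale T: abelian_group T by (rule T_abelian)

abbreviation "mm \<equiv> mfrac R S L"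
lemma mm_tc: "mm a x = tc (frag_of (a, x))" by (simp add: mfrac_def)

lemma mm_carr [simp]: "\<lbrakk>a \<in> carrier Q; x \<in> carrier L\<rbrakk> \<Longrightarrow> mm a x \<in> carrier T"
  by (simp add: mm_tc T_carr)

lemma rel_eq3: assumes "f \<in> carrier FG" "g \<in> carrier FG" "h \<in> carrier FG" "f - g - h \<in> NL"
  shows "tc f = tc g \<oplus>\<^bsub>T\<^esub> tc h"
proof -
  have "g + h \<in> carrier FG" using assms(2,3) monoid.m_closed[OF group.is_monoid[OF group_free_Abelian_group]]
    by (metis mult_free_Abelian_group)
  then show ?thesis using tc_add[OF assms(2,3)] tc_eq[OF assms(1), of "g + h"] assms(4) by (simp add: algebra_simps)
qed

lemma FG1: "\<lbrakk>a \<in> carrier Q; x \<in> carrier L\<rbrakk> \<Longrightarrow> frag_of (a, x) \<in> carrier FG" by simp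

lemma mm_add1: "\<lbrakk>a \<in> carrier Q; b \<in> carrier Q; x \<in> carrier L\<rbrakk> \<Longrightarrow> mm (a \<oplus>\<^bsub>Q\<^esub> b) x = mm a x \<oplus>\<^bsub>T\<^esub> mm b x"
  unfolding mm_tc apply (rule rel_eq3; (intro FG1 Q.a_closed; assumption)?)
  unfolding tensor_null_def apply (rule generate.incl) unfolding tensor_relations_def by blast

lemma mm_add2: "\<lbrakk>a \<in> carrier Q; x \<in> carrier L; y \<in> carrier L\<rbrakk> \<Longrightarrow> mm a (x \<oplus>\<^bsub>L\<^esub> y) = mm a x \<oplus>\<^bsub>T\<^esub> mm a y"
  unfolding mm_tc apply (rule rel_eq3; (intro FG1 L.M.a_closed; assumption)?)
  unfolding tensor_null_def apply (rule generate.incl) unfolding tensor_relations_def by blast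

lemma mm_bal: "\<lbrakk>r \<in> carrier R; a \<in> carrier Q; x \<in> carrier L\<rbrakk> \<Longrightarrow> mm (embed R S r \<otimes>\<^bsub>Q\<^esub> a) x = mm a (r \<odot>\<^bsub>L\<^esub> x)"
  unfolding mm_tc apply (rule tc_eq[THEN iffD2])
    apply (intro FG1 Q.m_closed frac_carr one_S; assumption)
    apply (intro FG1 L.smult_closed; assumption)
  unfolding tensor_null_def apply (rule generate.incl) unfolding tensor_relations_def by blast

lemma mm_frac: "\<lbrakk>r \<in> carrier R; s \<in> S; x \<in> carrier L\<rbrakk> \<Longrightarrow> mm (frac R S r s) x = mm (recip R S s) (r \<odot>\<^bsub>L\<^esub> x)"
  using mm_bal[of r "recip R S s" x] by simp

definition "gg = (\<lambda>(a, x). \<Union>(r, s)\<in>a. mf (r \<odot>\<^bsub>L\<^esub> x) s)"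

lemma gg: assumes "r \<in> carrier R" "s \<in> S" "x \<in> carrier L" shows "gg (frac R S r s, x) = mf (r \<odot>\<^bsub>L\<^esub> x) s"
proof -
  have m: "(r, s) \<in> frac R S r s" using assms by (simp add: frac_mf F.mf_self)
  have *: "mf (a \<odot>\<^bsub>L\<^esub> x) b = mf (r \<odot>\<^bsub>L\<^esub> x) s" if ab: "(a, b) \<in> frac R S r s" for a b
  proof -
    obtain u where u: "u \<in> S" "u \<otimes> (b \<otimes> r) = u \<otimes> (s \<otimes> a)" "a \<in> carrier R" "b \<in> S"
      using ab by (auto simp: frac_def)
    have "u \<odot>\<^bsub>L\<^esub> (s \<odot>\<^bsub>L\<^esub> (a \<odot>\<^bsub>L\<^esub> x)) = u \<odot>\<^bsub>L\<^esub> (b \<odot>\<^bsub>L\<^esub> (r \<odot>\<^bsub>L\<^esub> x))"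
      using assms u(1,3,4) u(2)[symmetric] by (simp add: L.smult_assoc1[symmetric] R.m_assoc)
    then show ?thesis using assms u(1,3,4) by (subst mf_eq) auto
  qed
  show ?thesis unfolding gg_def prod.case
    apply (rule UN_const) using m apply blast
    apply clarify by (rule *)
qed

lemma mm_recip_eq_iff:
  assumes "x \<in> carrier L" "y \<in> carrier L" "s \<in> S" "t \<in> S"
  shows "mm (recip R S s) x = mm (recip R S t) y \<longleftrightarrow> (\<exists>u\<in>S. u \<odot>\<^bsub>L\<^esub> (t \<odot>\<^bsub>L\<^esub> x) = u \<odot>\<^bsub>L\<^esub> (s \<odot>\<^bsub>L\<^esub> y))"
proof
  assume "\<exists>u\<in>S. u \<odot>\<^bsub>L\<^esub> (t \<odot>\<^bsub>L\<^esub> x) = u \<odot>\<^bsub>L\<^esub> (s \<odot>\<^bsub>L\<^esub> y)"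
  then obtain u where u: "u \<in> S" "u \<odot>\<^bsub>L\<^esub> (t \<odot>\<^bsub>L\<^esub> x) = u \<odot>\<^bsub>L\<^esub> (s \<odot>\<^bsub>L\<^esub> y)" by blast
  have "recip R S s = frac R S (u \<otimes> t) (u \<otimes> t \<otimes> s)" using assms u(1) by (intro frac_eqI) (auto simp: R.m_ac)
  then have 1: "mm (recip R S s) x = mm (recip R S (u \<otimes> t \<otimes> s)) ((u \<otimes> t) \<odot>\<^bsub>L\<^esub> x)"
    using mm_frac[of "u \<otimes> t" "u \<otimes> t \<otimes> s" x] assms u(1) by simp
  have "recip R S t = frac R S (u \<otimes> s) (u \<otimes> t \<otimes> s)" using assms u(1) by (intro frac_eqI) (auto simp: R.m_ac)
  then have 2: "mm (recip R S t) y = mm (recip R S (u \<otimes> t \<otimes> s)) ((u \<otimes> s) \<odot>\<^bsub>L\<^esub> y)"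
    using mm_frac[of "u \<otimes> s" "u \<otimes> t \<otimes> s" y] assms u(1) by simp
  show "mm (recip R S s) x = mm (recip R S t) y" unfolding 1 2 using assms u(1) by (simp add: L.smult_assoc1 u(2))
next
  assume eq: "mm (recip R S s) x = mm (recip R S t) y"
  interpret N: comm_group N by (rule N_group)
  have g: "gg \<in> carrier Q \<times> carrier L \<rightarrow> carrier N"
  proof
    fix z assume "z \<in> carrier Q \<times> carrier L"
    then obtain r s x where z: "z = (frac R S r s, x)" "r \<in> carrier R" "s \<in> S" "x \<in> carrier L"
      by (elim SigmaE frac_cases) blast
    then show "gg z \<in> carrier N" unfolding N_carr using gg L.smult_closed by blast
  qed
  obtain h where h: "h \<in> hom FG N" "\<And>z. z \<in> carrier Q \<times> carrier L \<Longrightarrow> h (frag_of z) = gg z"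
    by (rule N.free_Abelian_group_universal[of gg "carrier Q \<times> carrier L"]) (use g in blast)+
  interpret h: group_hom FG N h
    unfolding group_hom_def group_hom_axioms_def using h(1) N.is_group by simp
  have hd: "h (f - g) = h f \<otimes>\<^bsub>N\<^esub> inv\<^bsub>N\<^esub> h g" if "f \<in> carrier FG" "g \<in> carrier FG" for f g
  proof -
    have "inv\<^bsub>FG\<^esub> g = - g" by (rule inv_free_Abelian_group) (use that in simp)
    then show ?thesis using h.hom_mult[of f "inv\<^bsub>FG\<^esub> g"] h.hom_inv[of g] that by simp
  qed
  have dc: "f - g \<in> carrier FG" if "f \<in> carrier FG" "g \<in> carrier FG" for f g
    using that keysD by (metis carrier_free_Abelian_group_iff)
  have hm: "h (frag_of (frac R S r s, x)) = mf (r \<odot>\<^bsub>L\<^esub> x) s" if "r \<in> carrier R" "s \<in> S" "x \<in> carrier L" for r s x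
    using h(2)[of "(frac R S r s, x)"] gg that by simp
  have hf: "h (frag_of (a, x)) \<in> carrier N" if "a \<in> carrier Q" "x \<in> carrier L" for a x
    using that FG1 h.hom_closed by blast
  have k3: "f - g - k \<in> kernel FG N h"
    if "f \<in> carrier FG" "g \<in> carrier FG" "k \<in> carrier FG" "h f = h g \<otimes>\<^bsub>N\<^esub> h k" for f g k
  proof -
    have "h (f - g - k) = h g \<otimes>\<^bsub>N\<^esub> h k \<otimes>\<^bsub>N\<^esub> inv\<^bsub>N\<^esub> h g \<otimes>\<^bsub>N\<^esub> inv\<^bsub>N\<^esub> h k"
      using hd dc that by simp
    also have "\<dots> = \<one>\<^bsub>N\<^esub>"
      using h.hom_closed[OF that(2)] h.hom_closed[OF that(3)]
      by (metis N.inv_closed N.m_assoc N.m_closed N.m_comm N.r_inv N.r_one)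
    finally show ?thesis using dc that by (simp add: kernel_def)
  qed
  have "tensor_relations R Q (embed R S) L \<subseteq> kernel FG N h"
  proof
    fix f assume "f \<in> tensor_relations R Q (embed R S) L"
    then consider (1) a b x where "f = frag_of (a \<oplus>\<^bsub>Q\<^esub> b, x) - frag_of (a, x) - frag_of (b, x)"
        "a \<in> carrier Q" "b \<in> carrier Q" "x \<in> carrier L"
      | (2) a x y where "f = frag_of (a, x \<oplus>\<^bsub>L\<^esub> y) - frag_of (a, x) - frag_of (a, y)"
        "a \<in> carrier Q" "x \<in> carrier L" "y \<in> carrier L"
      | (3) r a x where "f = frag_of (embed R S r \<otimes>\<^bsub>Q\<^esub> a, x) - frag_of (a, r \<odot>\<^bsub>L\<^esub> x)"
        "r \<in> carrier R" "a \<in> carrier Q" "x \<in> carrier L"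
      unfolding tensor_relations_def by blast
    then show "f \<in> kernel FG N h"
    proof cases
      case 1
      obtain r s where a: "r \<in> carrier R" "s \<in> S" "a = frac R S r s" using 1 frac_cases by metis
      obtain q t where b: "q \<in> carrier R" "t \<in> S" "b = frac R S q t" using 1 frac_cases by metis
      show ?thesis unfolding 1(1)
        apply (rule k3)
        using 1 FG1 Q.a_closed apply (blast, blast, blast)
        using a b 1(4) by (simp add: hm L.smult_l_distr L.smult_assoc1)
    next
      case 2
      obtain r s where a: "r \<in> carrier R" "s \<in> S" "a = frac R S r s" using 2 frac_cases by metis
      show ?thesis unfolding 2(1)
        apply (rule k3)
        using 2 FG1 L.M.a_closed apply (blast, blast, blast)
        using a 2(3,4) apply (simp add: hm)
        apply (rule mf_eqI) by (simp_all add: L.smult_r_distr L.smult_assoc1[symmetric] R.m_ac)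
    next
      case 3
      obtain q s where a: "q \<in> carrier R" "s \<in> S" "a = frac R S q s" using 3 frac_cases by metis
      have c: "frag_of (embed R S r \<otimes>\<^bsub>Q\<^esub> a, x) \<in> carrier FG" "frag_of (a, r \<odot>\<^bsub>L\<^esub> x) \<in> carrier FG"
        using 3 by (simp_all del: carrier_free_Abelian_group_iff)
      have "h (frag_of (embed R S r \<otimes>\<^bsub>Q\<^esub> a, x)) = h (frag_of (a, r \<odot>\<^bsub>L\<^esub> x))"
        using a 3(2,4) by (simp add: hm L.smult_assoc1[symmetric] R.m_ac)
      then show ?thesis unfolding 3(1) kernel_def using hd[OF c] dc[OF c] h.hom_closed[OF c(2)] N.r_inv by simp
    qed
  qed
  then have sub: "NL \<subseteq> kernel FG N h"
    unfolding tensor_null_def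
    by (rule group.generate_subgroup_incl[OF group_free_Abelian_group _ h.subgroup_kernel])
  have c: "frag_of (recip R S s, x) \<in> carrier FG" "frag_of (recip R S t, y) \<in> carrier FG"
    using assms by (simp_all del: carrier_free_Abelian_group_iff)
  have "frag_of (recip R S s, x) - frag_of (recip R S t, y) \<in> kernel FG N h"
    using eq tc_eq[OF c] sub unfolding mm_tc by blast
  then have "h (frag_of (recip R S s, x)) \<otimes>\<^bsub>N\<^esub> inv\<^bsub>N\<^esub> h (frag_of (recip R S t, y)) = \<one>\<^bsub>N\<^esub>"
    using hd[OF c] by (simp add: kernel_def)
  then have "h (frag_of (recip R S s, x)) = h (frag_of (recip R S t, y))"
    using h.hom_closed[OF c(1)] h.hom_closed[OF c(2)] by (metis N.inv_equality N.inv_inv N.inv_closed)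
  then have "mf x s = mf y t" using assms by (simp add: hm)
  then show "\<exists>u\<in>S. u \<odot>\<^bsub>L\<^esub> (t \<odot>\<^bsub>L\<^esub> x) = u \<odot>\<^bsub>L\<^esub> (s \<odot>\<^bsub>L\<^esub> y)"
    using mf_eq assms by blast
qed

lemma mm_zero: assumes "x \<in> carrier L" shows "mm \<zero>\<^bsub>Q\<^esub> x = \<zero>\<^bsub>T\<^esub>"
proof -
  have "mm \<zero>\<^bsub>Q\<^esub> x = mm \<zero>\<^bsub>Q\<^esub> x \<oplus>\<^bsub>T\<^esub> mm \<zero>\<^bsub>Q\<^esub> x"
    using mm_add1[of "\<zero>\<^bsub>Q\<^esub>" "\<zero>\<^bsub>Q\<^esub>" x] assms Q.r_zero[OF Q.zero_closed] Q.zero_closed by argo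
  then show ?thesis using T.add.r_cancel_one'[of "mm \<zero>\<^bsub>Q\<^esub> x" "mm \<zero>\<^bsub>Q\<^esub> x"] mm_carr[OF Q.zero_closed assms] by simp
qed

lemma mm_uminus: assumes "a \<in> carrier Q" "x \<in> carrier L" shows "mm (\<ominus>\<^bsub>Q\<^esub> a) x = \<ominus>\<^bsub>T\<^esub> mm a x"
proof (rule T.minus_equality[symmetric])
  have "mm (\<ominus>\<^bsub>Q\<^esub> a) x \<oplus>\<^bsub>T\<^esub> mm a x = mm (\<ominus>\<^bsub>Q\<^esub> a \<oplus>\<^bsub>Q\<^esub> a) x"
    using mm_add1[of "\<ominus>\<^bsub>Q\<^esub> a" a x] Q.a_inv_closed[OF assms(1)] assms by argo
  then show "mm (\<ominus>\<^bsub>Q\<^esub> a) x \<oplus>\<^bsub>T\<^esub> mm a x = \<zero>\<^bsub>T\<^esub>" using Q.l_neg[OF assms(1)] mm_zero[OF assms(2)] by argo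
qed (use mm_carr Q.a_inv_closed assms in auto)

lemma mm_add_frac:
  assumes "s \<in> S" "t \<in> S" "x \<in> carrier L" "y \<in> carrier L"
  shows "mm (recip R S s) x \<oplus>\<^bsub>T\<^esub> mm (recip R S t) y = mm (recip R S (s \<otimes> t)) (t \<odot>\<^bsub>L\<^esub> x \<oplus>\<^bsub>L\<^esub> s \<odot>\<^bsub>L\<^esub> y)"
proof -
  have "mm (recip R S s) x = mm (recip R S (s \<otimes> t)) (t \<odot>\<^bsub>L\<^esub> x)"
    using assms one_S by (subst mm_recip_eq_iff) (auto simp: L.smult_assoc1[symmetric] R.m_ac)
  moreover have "mm (recip R S t) y = mm (recip R S (s \<otimes> t)) (s \<odot>\<^bsub>L\<^esub> y)"
    using assms one_S by (subst mm_recip_eq_iff) (auto simp: L.smult_assoc1[symmetric] R.m_ac)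
  ultimately show ?thesis using mm_add2[of "recip R S (s \<otimes> t)" "t \<odot>\<^bsub>L\<^esub> x" "s \<odot>\<^bsub>L\<^esub> y"] assms by simp
qed

lemma mm_uminus2:
  assumes "a \<in> carrier Q" "z \<in> carrier L" shows "mm a (\<ominus>\<^bsub>L\<^esub> z) = \<ominus>\<^bsub>T\<^esub> mm a z"
proof (rule T.minus_equality[symmetric])
  have "mm a \<zero>\<^bsub>L\<^esub> = mm a \<zero>\<^bsub>L\<^esub> \<oplus>\<^bsub>T\<^esub> mm a \<zero>\<^bsub>L\<^esub>"
    using mm_add2[of a "\<zero>\<^bsub>L\<^esub>" "\<zero>\<^bsub>L\<^esub>"] assms by simp
  then have "mm a \<zero>\<^bsub>L\<^esub> = \<zero>\<^bsub>T\<^esub>" using T.add.r_cancel_one'[of "mm a \<zero>\<^bsub>L\<^esub>" "mm a \<zero>\<^bsub>L\<^esub>"] mm_carr[of a "\<zero>\<^bsub>L\<^esub>"] assms by simp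
  then show "mm a (\<ominus>\<^bsub>L\<^esub> z) \<oplus>\<^bsub>T\<^esub> mm a z = \<zero>\<^bsub>T\<^esub>" using mm_add2[of a "\<ominus>\<^bsub>L\<^esub> z" z] assms by (simp add: L.M.l_neg)
qed (use mm_carr assms in auto)

lemma T_cases: assumes "X \<in> carrier T" obtains s x where "s \<in> S" "x \<in> carrier L" "X = mm (recip R S s) x"
proof -
  obtain f where f: "f \<in> carrier FG" "X = tc f" using assms T_carr by auto
  have "Poly_Mapping.keys f \<subseteq> carrier Q \<times> carrier L" using f(1) by simp
  then have "\<exists>s x. s \<in> S \<and> x \<in> carrier L \<and> tc f = mm (recip R S s) x"
  proof (rule free_Abelian_group_induct[where P = "\<lambda>f. \<exists>s x. s \<in> S \<and> x \<in> carrier L \<and> tc f = mm (recip R S s) x"])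
    have "tc 0 \<oplus>\<^bsub>T\<^esub> tc 0 = tc 0" using tc_add[of 0 0] by simp
    moreover have "tc 0 \<in> carrier T" unfolding T_carr by simp
    ultimately have "tc 0 = \<zero>\<^bsub>T\<^esub>" using T.add.r_cancel_one by metis
    also have "\<dots> = mm (recip R S \<one>) \<zero>\<^bsub>L\<^esub>"
      using mm_frac[of "\<zero>" \<one> "\<zero>\<^bsub>L\<^esub>"] mm_zero[of "\<zero>\<^bsub>L\<^esub>"] by (simp add: Q_zero)
    finally show "\<exists>s x. s \<in> S \<and> x \<in> carrier L \<and> tc 0 = mm (recip R S s) x" using one_S L.M.zero_closed by blast
  next
    fix f g :: "('r \<times> 'r) set \<times> 'l \<Rightarrow>\<^sub>0 int"
    assume k: "Poly_Mapping.keys f \<subseteq> carrier Q \<times> carrier L" "Poly_Mapping.keys g \<subseteq> carrier Q \<times> carrier L"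
      and "\<exists>s x. s \<in> S \<and> x \<in> carrier L \<and> tc f = mm (recip R S s) x"
        "\<exists>s x. s \<in> S \<and> x \<in> carrier L \<and> tc g = mm (recip R S s) x"
    then obtain s x t y where *: "s \<in> S" "x \<in> carrier L" "tc f = mm (recip R S s) x"
      "t \<in> S" "y \<in> carrier L" "tc g = mm (recip R S t) y" by blast
    have fg: "f \<in> carrier FG" "g \<in> carrier FG" "f - g \<in> carrier FG" using k keysD[OF k] by simp_all
    have "tc (f - g) \<oplus>\<^bsub>T\<^esub> tc g = tc f" using tc_add[OF fg(3,2)] by simp
    moreover have "tc (f - g) \<in> carrier T" "tc g \<in> carrier T" using fg unfolding T_carr by blast+
    ultimately have "tc (f - g) = tc f \<oplus>\<^bsub>T\<^esub> \<ominus>\<^bsub>T\<^esub> tc g" by (metis T.a_assoc T.a_inv_closed T.r_neg T.r_zero)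
    also have "\<dots> = mm (recip R S s) x \<oplus>\<^bsub>T\<^esub> mm (recip R S t) (\<ominus>\<^bsub>L\<^esub> y)"
      using mm_uminus2[of "recip R S t" y] * by simp
    also have "\<dots> = mm (recip R S (s \<otimes> t)) (t \<odot>\<^bsub>L\<^esub> x \<oplus>\<^bsub>L\<^esub> s \<odot>\<^bsub>L\<^esub> (\<ominus>\<^bsub>L\<^esub> y))"
      by (rule mm_add_frac) (use * in auto)
    finally show "\<exists>s x. s \<in> S \<and> x \<in> carrier L \<and> tc (f - g) = mm (recip R S s) x"
      using *(1,2,4,5) by (intro exI conjI) auto
  next
    fix z assume "z \<in> carrier Q \<times> carrier L"
    then obtain a x where z: "z = (a, x)" "a \<in> carrier Q" "x \<in> carrier L" by blast
    then obtain r s where a: "r \<in> carrier R" "s \<in> S" "a = frac R S r s" using frac_cases by metis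
    have "tc (frag_of z) = mm (recip R S s) (r \<odot>\<^bsub>L\<^esub> x)" using mm_frac[OF a(1,2) z(3)] z a by (simp add: mm_tc)
    then show "\<exists>s x. s \<in> S \<and> x \<in> carrier L \<and> tc (frag_of z) = mm (recip R S s) x"
      using L.smult_closed a(1,2) z(3) by blast
  qed
  then show thesis using that f by blast
qed

lemma smult_frag:
  assumes "a \<in> carrier Q" "b \<in> carrier Q" "x \<in> carrier L"
  shows "a \<odot>\<^bsub>T\<^esub> mm b x = mm (a \<otimes>\<^bsub>Q\<^esub> b) x"
proof -
  let ?E = "frag_extend (\<lambda>(b, x). frag_of (a \<otimes>\<^bsub>Q\<^esub> b, x)) :: _ \<Rightarrow> (('r \<times> 'r) set \<times> 'l \<Rightarrow>\<^sub>0 int)"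
  have cl: "?E f \<in> carrier FG" if "f \<in> carrier FG" for f
  proof -
    have "Poly_Mapping.keys (?E f) \<subseteq> (\<Union>z\<in>Poly_Mapping.keys f. Poly_Mapping.keys (case z of (b, x) \<Rightarrow> frag_of (a \<otimes>\<^bsub>Q\<^esub> b, x)))"
      by (rule keys_frag_extend)
    also have "\<dots> \<subseteq> carrier Q \<times> carrier L" 
    proof (rule UN_least)
      fix z assume "z \<in> Poly_Mapping.keys f"
      then have "z \<in> carrier Q \<times> carrier L" using that by auto
      then show "Poly_Mapping.keys (case z of (b, x) \<Rightarrow> frag_of (a \<otimes>\<^bsub>Q\<^esub> b, x)) \<subseteq> carrier Q \<times> carrier L"
        using Q.m_closed[OF assms(1)] by (cases z) simp
    qed
    finally show ?thesis by simp
  qed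
  interpret SG: subgroup NL FG by (rule NL_subgroup)
  have rel: "?E f \<in> NL" if "f \<in> tensor_relations R Q (embed R S) L" for f
  proof -
    have "?E f \<in> tensor_relations R Q (embed R S) L"
      using that unfolding tensor_relations_def
      apply (elim UnE CollectE exE conjE)
      subgoal for b c x
        apply (rule UnI1, rule UnI1, rule CollectI)
        apply (rule exI[of _ "a \<otimes>\<^bsub>Q\<^esub> b"], rule exI[of _ "a \<otimes>\<^bsub>Q\<^esub> c"], rule exI[of _ x])
        using Q.m_closed[OF assms(1)] Q.r_distr[of b c a] assms(1) by (simp add: frag_extend_diff)
      subgoal for b x y
        apply (rule UnI1, rule UnI2, rule CollectI)
        apply (rule exI[of _ "a \<otimes>\<^bsub>Q\<^esub> b"], rule exI[of _ x], rule exI[of _ y])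
        using Q.m_closed[OF assms(1)] by (simp add: frag_extend_diff)
      subgoal for r b x
        apply (rule UnI2, rule CollectI)
        apply (rule exI[of _ r], rule exI[of _ "a \<otimes>\<^bsub>Q\<^esub> b"], rule exI[of _ x])
        using Q.m_closed[OF assms(1)] Q.m_lcomm[of a "embed R S r" b] assms(1) frac_carr[of r \<one>] one_S by (simp add: frag_extend_diff)
      done
    then show ?thesis unfolding tensor_null_def by (rule generate.incl)
  qed
  have nl: "?E f \<in> NL" if "f \<in> NL" for f
    using that unfolding tensor_null_def
  proof (induction rule: generate.induct)
    case one then show ?case using SG.one_closed by (simp add: tensor_null_def)
  next
    case (incl h) then show ?case using rel by (simp add: tensor_null_def)
  next
    case (inv h) 
    have hc: "h \<in> carrier FG" using inv rels_sub by blast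
    then have "inv\<^bsub>FG\<^esub> h = - h" by (intro inv_free_Abelian_group) simp
    moreover have "inv\<^bsub>FG\<^esub> (?E h) = - ?E h" using cl[OF hc] by (intro inv_free_Abelian_group) simp
    moreover have "inv\<^bsub>FG\<^esub> (?E h) \<in> NL" by (rule SG.m_inv_closed[OF rel[OF inv]])
    ultimately show ?case by (simp add: frag_extend_minus tensor_null_def)
  next
    case (eng h k) then show ?case using SG.m_closed by (simp add: frag_extend_add tensor_null_def)
  qed
  have "tc (?E f) = tc (?E g)" if "f \<in> carrier FG" "g \<in> carrier FG" "f - g \<in> NL" for f g
    using tc_eq[OF cl[OF that(1)] cl[OF that(2)]] nl[OF that(3)] by (simp add: frag_extend_diff)
  moreover have "f \<in> carrier FG \<and> tc f = mm b x" if "f \<in> mm b x" for f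
  proof -
    have h: "f \<in> NL #>\<^bsub>FG\<^esub> frag_of (b, x)" using that unfolding mm_tc tensor_class_def .
    have "f \<in> carrier FG"
      using h SG.subset group.is_monoid[OF group_free_Abelian_group, THEN monoid.m_closed] FG1[OF assms(2,3)] unfolding r_coset_def by blast
    then show ?thesis
      using group.repr_independence[OF group_free_Abelian_group h FG1[OF assms(2,3)] NL_subgroup] unfolding mm_tc tensor_class_def by simp
  qed
  ultimately have "tc (?E f) = mm (a \<otimes>\<^bsub>Q\<^esub> b) x" if "f \<in> mm b x" for f
    using that tc_eq[of f "frag_of (b, x)"] FG1[OF assms(2,3)] unfolding mm_tc
    by (metis (no_types, lifting) frag_extend_of old.prod.case)
  moreover have "frag_of (b, x) \<in> mm b x" unfolding mm_tc tensor_class_def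
    by (rule group.rcos_self[OF group_free_Abelian_group FG1[OF assms(2,3)] NL_subgroup])
  ultimately show ?thesis unfolding module_localization_def extend_scalars_def
    by simp blast
qed

end

locale lie_rinehart_localization = lie_rinehart K R L br anc + localization_setup R L S
  for K :: "('k, 'c) ring_scheme" and R :: "('k, 'r, 'd) module_scheme" (structure)
    and L :: "('r, 'l, 'e) module_scheme" and br and anc and S
begin

lemma anc_c [simp]: "\<lbrakk>x \<in> carrier L; a \<in> carrier R\<rbrakk> \<Longrightarrow> anc x a \<in> carrier R"
  using anc_derivation[of x] by (auto simp: derivations_def)
lemma anc_m: "\<lbrakk>x \<in> carrier L; a \<in> carrier R; b \<in> carrier R\<rbrakk> \<Longrightarrow> anc x (a \<otimes> b) = a \<otimes> anc x b \<oplus> anc x a \<otimes> b"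
  using anc_derivation by (auto simp: derivations_def)
lemma br_c [simp]: "\<lbrakk>x \<in> carrier L; y \<in> carrier L\<rbrakk> \<Longrightarrow> br x y \<in> carrier L"
  using Lie.br_closed by (simp add: restrict_scalars_def)
lemma rs_simps: "carrier (restrict_scalars R L) = carrier L" "add (restrict_scalars R L) = add L"
  "ring.zero (restrict_scalars R L) = ring.zero L"
  by (simp_all add: restrict_scalars_def)

lemma br_anti: assumes "x \<in> carrier L" "y \<in> carrier L" shows "br y x = \<ominus>\<^bsub>L\<^esub> br x y"
proof -
  have z: "br (x \<oplus>\<^bsub>L\<^esub> y) (x \<oplus>\<^bsub>L\<^esub> y) = \<zero>\<^bsub>L\<^esub>" "br x x = \<zero>\<^bsub>L\<^esub>" "br y y = \<zero>\<^bsub>L\<^esub>"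
    using Lie.br_self assms unfolding rs_simps by auto
  have "br (x \<oplus>\<^bsub>L\<^esub> y) (x \<oplus>\<^bsub>L\<^esub> y) = br y x \<oplus>\<^bsub>L\<^esub> br x y"
    using Lie.br_add_left[of x y "x \<oplus>\<^bsub>L\<^esub> y"] Lie.br_add_right[of x x y] Lie.br_add_right[of y x y] assms z(2,3)
    unfolding rs_simps by (simp add: L.M.a_comm)
  then show ?thesis using z(1) assms by (metis L.M.minus_equality br_c)
qed

definition Z where "Z s x t y = mm (frac R S \<one> (s \<otimes> t)) (br x y)
   \<oplus>\<^bsub>T\<^esub> mm (frac R S (\<ominus> anc x t) (s \<otimes> (t \<otimes> t))) y \<oplus>\<^bsub>T\<^esub> mm (frac R S (anc y s) (t \<otimes> (s \<otimes> s))) x"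

lemma Z_eq:
  assumes "s \<in> S" "t \<in> S" "x \<in> carrier L" "y \<in> carrier L"
  shows "mm (recip R S s \<otimes>\<^bsub>Q\<^esub> recip R S t) (br x y)
            \<oplus>\<^bsub>T\<^esub> mm (recip R S s \<otimes>\<^bsub>Q\<^esub> anchor_recip R S anc x t) y
            \<ominus>\<^bsub>T\<^esub> mm (recip R S t \<otimes>\<^bsub>Q\<^esub> anchor_recip R S anc y s) x = Z s x t y"
proof -
  have p: "recip R S t [^]\<^bsub>Q\<^esub> (2::nat) = frac R S \<one> (t \<otimes> t)" if "t \<in> S" for t
    using that by (simp add: numeral_2_eq_2 Q_one)
  have a: "anchor_recip R S anc x t = frac R S (\<ominus> anc x t) (t \<otimes> t)" if "t \<in> S" "x \<in> carrier L" for x t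
    using that by (simp add: anchor_recip_def p)
  have b: "mm (frac R S (anc y s) (t \<otimes> (s \<otimes> s))) x = \<ominus>\<^bsub>T\<^esub> mm (frac R S (\<ominus> anc y s) (t \<otimes> (s \<otimes> s))) x"
    using mm_uminus[of "frac R S (\<ominus> anc y s) (t \<otimes> (s \<otimes> s))" x] assms by simp
  show ?thesis unfolding Z_def b a_minus_def using assms by (simp add: a)
qed

lemma Z_c: "\<lbrakk>s \<in> S; t \<in> S; x \<in> carrier L; y \<in> carrier L\<rbrakk> \<Longrightarrow> Z s x t y \<in> carrier T"
  unfolding Z_def by (intro T.a_closed mm_carr frac_carr) auto

lemma Z_swap:
  assumes "s \<in> S" "t \<in> S" "x \<in> carrier L" "y \<in> carrier L"
  shows "Z s x t y = \<ominus>\<^bsub>T\<^esub> Z t y s x"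
proof -
  have n: "mm a (\<ominus>\<^bsub>L\<^esub> z) = \<ominus>\<^bsub>T\<^esub> mm a z" if "a \<in> carrier Q" "z \<in> carrier L" for a z
  proof (rule T.minus_equality[symmetric])
    show "mm a (\<ominus>\<^bsub>L\<^esub> z) \<oplus>\<^bsub>T\<^esub> mm a z = \<zero>\<^bsub>T\<^esub>"
    proof -
      have "mm a \<zero>\<^bsub>L\<^esub> = mm a \<zero>\<^bsub>L\<^esub> \<oplus>\<^bsub>T\<^esub> mm a \<zero>\<^bsub>L\<^esub>"
        using mm_add2[of a "\<zero>\<^bsub>L\<^esub>" "\<zero>\<^bsub>L\<^esub>"] that by simp
      then have "mm a \<zero>\<^bsub>L\<^esub> = \<zero>\<^bsub>T\<^esub>" using T.add.r_cancel_one'[of "mm a \<zero>\<^bsub>L\<^esub>" "mm a \<zero>\<^bsub>L\<^esub>"] mm_carr[of a "\<zero>\<^bsub>L\<^esub>"] that by simp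
      then show ?thesis using mm_add2[of a "\<ominus>\<^bsub>L\<^esub> z" z] that by (simp add: L.M.l_neg)
    qed
  qed (use mm_carr that in auto)
  have 1: "mm (frac R S \<one> (s \<otimes> t)) (br x y) = \<ominus>\<^bsub>T\<^esub> mm (frac R S \<one> (t \<otimes> s)) (br y x)"
    using n[of "frac R S \<one> (t \<otimes> s)" "br y x"] br_anti[of y x] assms by (simp add: R.m_comm)
  have 2: "mm (frac R S (\<ominus> anc x t) (s \<otimes> (t \<otimes> t))) y = \<ominus>\<^bsub>T\<^esub> mm (frac R S (anc x t) (s \<otimes> (t \<otimes> t))) y"
    using mm_uminus[of "frac R S (anc x t) (s \<otimes> (t \<otimes> t))" y] assms by simp
  have 3: "mm (frac R S (anc y s) (t \<otimes> (s \<otimes> s))) x = \<ominus>\<^bsub>T\<^esub> mm (frac R S (\<ominus> anc y s) (t \<otimes> (s \<otimes> s))) x"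
    using mm_uminus[of "frac R S (\<ominus> anc y s) (t \<otimes> (s \<otimes> s))" x] assms by simp
  have c: "mm (frac R S \<one> (t \<otimes> s)) (br y x) \<in> carrier T" "mm (frac R S (anc x t) (s \<otimes> (t \<otimes> t))) y \<in> carrier T"
     "mm (frac R S (\<ominus> anc y s) (t \<otimes> (s \<otimes> s))) x \<in> carrier T"
    using assms by (auto intro!: mm_carr frac_carr)
  show ?thesis unfolding Z_def 1 2 3 using c by (simp add: T.minus_add T.a_ac)
qed

lemma Z_scale:
  assumes "s \<in> S" "t \<in> S" "x \<in> carrier L" "y \<in> carrier L" "w \<in> S"
  shows "Z (w \<otimes> s) (w \<odot>\<^bsub>L\<^esub> x) t y = Z s x t y"
proof -
  let ?d = "w \<otimes> (s \<otimes> t)"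
  have c: "br x y \<in> carrier L" "anc y w \<in> carrier R" "anc y s \<in> carrier R" "anc x t \<in> carrier R" "?d \<in> S"
    using assms by auto
  have wc: "w \<in> carrier R" "s \<in> carrier R" "t \<in> carrier R" using assms by auto
  have "br (w \<odot>\<^bsub>L\<^esub> x) y = \<ominus>\<^bsub>L\<^esub> (w \<odot>\<^bsub>L\<^esub> br y x \<oplus>\<^bsub>L\<^esub> anc y w \<odot>\<^bsub>L\<^esub> x)"
    using br_anti[of y "w \<odot>\<^bsub>L\<^esub> x"] br_leibniz[of y x w] assms by simp
  also have "\<dots> = w \<odot>\<^bsub>L\<^esub> br x y \<oplus>\<^bsub>L\<^esub> (\<ominus> anc y w) \<odot>\<^bsub>L\<^esub> x"
    using br_anti[of x y] assms c by (simp add: L.M.minus_add L.smult_r_minus L.smult_l_minus)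
  finally have b: "br (w \<odot>\<^bsub>L\<^esub> x) y = w \<odot>\<^bsub>L\<^esub> br x y \<oplus>\<^bsub>L\<^esub> (\<ominus> anc y w) \<odot>\<^bsub>L\<^esub> x" .
  have 1: "mm (frac R S \<one> (w \<otimes> s \<otimes> t)) (br (w \<odot>\<^bsub>L\<^esub> x) y) =
      mm (frac R S \<one> (s \<otimes> t)) (br x y) \<oplus>\<^bsub>T\<^esub> mm (frac R S (\<ominus> anc y w) ?d) x"
  proof -
    have "frac R S \<one> (s \<otimes> t) = frac R S w ?d" using assms by (intro frac_eqI) (auto simp: R.m_ac)
    then have "mm (frac R S \<one> (s \<otimes> t)) (br x y) = mm (recip R S ?d) (w \<odot>\<^bsub>L\<^esub> br x y)"
      using mm_frac[of w ?d "br x y"] wc c by simp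
    moreover have "mm (frac R S (\<ominus> anc y w) ?d) x = mm (recip R S ?d) ((\<ominus> anc y w) \<odot>\<^bsub>L\<^esub> x)"
      using mm_frac[of "\<ominus> anc y w" ?d x] wc c assms by simp
    ultimately show ?thesis unfolding b using mm_add2[of "recip R S ?d" "w \<odot>\<^bsub>L\<^esub> br x y" "(\<ominus> anc y w) \<odot>\<^bsub>L\<^esub> x"] wc c assms
      by (simp add: R.m_assoc)
  qed
  have 2: "frac R S (\<ominus> anc (w \<odot>\<^bsub>L\<^esub> x) t) (w \<otimes> s \<otimes> (t \<otimes> t)) = frac R S (\<ominus> anc x t) (s \<otimes> (t \<otimes> t))"
  proof -
    have "anc (w \<odot>\<^bsub>L\<^esub> x) t = w \<otimes> anc x t" using anc_smult wc assms by simp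
    then show ?thesis using wc c assms by (intro frac_eqI) (auto simp: R.m_ac R.r_minus R.l_minus)
  qed
  have 3: "mm (frac R S (anc y (w \<otimes> s)) (t \<otimes> (w \<otimes> s \<otimes> (w \<otimes> s)))) (w \<odot>\<^bsub>L\<^esub> x) =
     mm (frac R S (anc y s) (t \<otimes> (s \<otimes> s))) x \<oplus>\<^bsub>T\<^esub> mm (frac R S (anc y w) ?d) x"
  proof -
    let ?e = "t \<otimes> (w \<otimes> s \<otimes> (w \<otimes> s))"
    have e: "?e \<in> S" using assms by simp
    have "mm (frac R S (anc y (w \<otimes> s)) ?e) (w \<odot>\<^bsub>L\<^esub> x) = mm (embed R S w \<otimes>\<^bsub>Q\<^esub> frac R S (anc y (w \<otimes> s)) ?e) x"
      using mm_bal[of w "frac R S (anc y (w \<otimes> s)) ?e" x] wc e assms by simp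
    also have "embed R S w \<otimes>\<^bsub>Q\<^esub> frac R S (anc y (w \<otimes> s)) ?e = frac R S (anc y s) (t \<otimes> (s \<otimes> s)) \<oplus>\<^bsub>Q\<^esub> frac R S (anc y w) ?d"
    proof -
      have x1: "embed R S w \<otimes>\<^bsub>Q\<^esub> frac R S (anc y (w \<otimes> s)) ?e = frac R S (w \<otimes> (w \<otimes> anc y s \<oplus> anc y w \<otimes> s)) ?e"
        using wc e assms c anc_m[of y w s] by simp
      have x2: "frac R S (anc y s) (t \<otimes> (s \<otimes> s)) \<oplus>\<^bsub>Q\<^esub> frac R S (anc y w) ?d =
         frac R S (?d \<otimes> anc y s \<oplus> t \<otimes> (s \<otimes> s) \<otimes> anc y w) (t \<otimes> (s \<otimes> s) \<otimes> ?d)"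
        using wc c assms by (intro frac_add) auto
      show ?thesis unfolding x1 x2
        using wc c assms e by (intro frac_eqI) (auto simp: R.m_ac R.r_distr)
    qed
    finally show ?thesis using mm_add1[of "frac R S (anc y s) (t \<otimes> (s \<otimes> s))" "frac R S (anc y w) ?d" x] wc c assms by simp
  qed
  have m: "mm (frac R S (\<ominus> anc y w) ?d) x = \<ominus>\<^bsub>T\<^esub> mm (frac R S (anc y w) ?d) x"
    using mm_uminus[of "frac R S (anc y w) ?d" x] c assms by simp
  have k: "mm (frac R S \<one> (s \<otimes> t)) (br x y) \<in> carrier T" "mm (frac R S (anc y w) ?d) x \<in> carrier T"
    "mm (frac R S (\<ominus> anc x t) (s \<otimes> (t \<otimes> t))) y \<in> carrier T" "mm (frac R S (anc y s) (t \<otimes> (s \<otimes> s))) x \<in> carrier T"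
    using wc c assms by (auto intro!: mm_carr frac_carr)
  have grp: "A \<oplus>\<^bsub>T\<^esub> \<ominus>\<^bsub>T\<^esub> B \<oplus>\<^bsub>T\<^esub> C \<oplus>\<^bsub>T\<^esub> (D \<oplus>\<^bsub>T\<^esub> B) = A \<oplus>\<^bsub>T\<^esub> C \<oplus>\<^bsub>T\<^esub> D"
    if "A \<in> carrier T" "B \<in> carrier T" "C \<in> carrier T" "D \<in> carrier T" for A B C D
  proof -
    have "A \<oplus>\<^bsub>T\<^esub> \<ominus>\<^bsub>T\<^esub> B \<oplus>\<^bsub>T\<^esub> C \<oplus>\<^bsub>T\<^esub> (D \<oplus>\<^bsub>T\<^esub> B) = A \<oplus>\<^bsub>T\<^esub> C \<oplus>\<^bsub>T\<^esub> D \<oplus>\<^bsub>T\<^esub> (\<ominus>\<^bsub>T\<^esub> B \<oplus>\<^bsub>T\<^esub> B)"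
      using that by (simp only: T.a_ac T.a_closed T.a_inv_closed)
    then show ?thesis using that by (simp add: T.l_neg)
  qed
  show ?thesis unfolding Z_def 1 2 3 m using grp k by simp
qed

lemma Z_wd1:
  assumes "s \<in> S" "t \<in> S" "x \<in> carrier L" "y \<in> carrier L" "s' \<in> S" "x' \<in> carrier L"
    "mm (recip R S s) x = mm (recip R S s') x'"
  shows "Z s x t y = Z s' x' t y"
proof -
  obtain u where u: "u \<in> S" "u \<odot>\<^bsub>L\<^esub> (s' \<odot>\<^bsub>L\<^esub> x) = u \<odot>\<^bsub>L\<^esub> (s \<odot>\<^bsub>L\<^esub> x')" using mm_recip_eq_iff assms by blast
  have "Z s x t y = Z (u \<otimes> s' \<otimes> s) ((u \<otimes> s') \<odot>\<^bsub>L\<^esub> x) t y" using Z_scale u assms by simp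
  also have "\<dots> = Z (u \<otimes> s \<otimes> s') ((u \<otimes> s) \<odot>\<^bsub>L\<^esub> x') t y"
  proof -
    have "u \<otimes> s' \<otimes> s = u \<otimes> s \<otimes> s'" "(u \<otimes> s') \<odot>\<^bsub>L\<^esub> x = (u \<otimes> s) \<odot>\<^bsub>L\<^esub> x'"
      using u(1) assms by (simp add: R.m_ac, simp add: L.smult_assoc1 u(2))
    then show ?thesis by simp
  qed
  also have "\<dots> = Z s' x' t y" using Z_scale u assms by simp
  finally show ?thesis .
qed

lemma local_bracket_eq:
  assumes "s \<in> S" "t \<in> S" "x \<in> carrier L" "y \<in> carrier L"
  shows "local_bracket R S L br anc (mm (recip R S s) x) (mm (recip R S t) y) =
    mm (recip R S s \<otimes>\<^bsub>Q\<^esub> recip R S t) (br x y)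
            \<oplus>\<^bsub>T\<^esub> mm (recip R S s \<otimes>\<^bsub>Q\<^esub> anchor_recip R S anc x t) y
            \<ominus>\<^bsub>T\<^esub> mm (recip R S t \<otimes>\<^bsub>Q\<^esub> anchor_recip R S anc y s) x"
proof -
  have *: "Z s x t y = Z s' x' t' y'" if "s' \<in> S" "t' \<in> S" "x' \<in> carrier L" "y' \<in> carrier L"
    "mm (recip R S s) x = mm (recip R S s') x'" "mm (recip R S t) y = mm (recip R S t') y'" for s' t' x' y'
  proof -
    have "Z s x t y = Z s' x' t y" using Z_wd1 that assms by blast
    also have "\<dots> = \<ominus>\<^bsub>T\<^esub> Z t y s' x'" using Z_swap that assms by blast
    also have "\<dots> = \<ominus>\<^bsub>T\<^esub> Z t' y' s' x'" using Z_wd1[of t s' y x' t' y'] that assms by simp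
    also have "\<dots> = Z s' x' t' y'" using Z_swap[of s' t' x' y'] that assms by simp
    finally show ?thesis .
  qed
  show ?thesis unfolding local_bracket_def Let_def
    by (rule the_equality, use assms in blast) (metis * Z_eq assms)
qed

definition E where "E s x t r = frac R S (t \<otimes> anc x r \<oplus> \<ominus> (anc x t \<otimes> r)) (s \<otimes> (t \<otimes> t))"

lemma E_eq: assumes "s \<in> S" "t \<in> S" "x \<in> carrier L" "r \<in> carrier R"
  shows "recip R S s \<otimes>\<^bsub>Q\<^esub> recip R S t \<otimes>\<^bsub>Q\<^esub> embed R S (anc x r)
            \<ominus>\<^bsub>Q\<^esub> recip R S s \<otimes>\<^bsub>Q\<^esub> recip R S t [^]\<^bsub>Q\<^esub> (2::nat) \<otimes>\<^bsub>Q\<^esub> embed R S (anc x t)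
              \<otimes>\<^bsub>Q\<^esub> embed R S r = E s x t r"
proof -
  have p: "recip R S t [^]\<^bsub>Q\<^esub> (2::nat) = frac R S \<one> (t \<otimes> t)"
    using assms by (simp add: numeral_2_eq_2 Q_one)
  have c: "anc x r \<in> carrier R" "anc x t \<in> carrier R" "s \<in> carrier R" "t \<in> carrier R" using assms by auto
  show ?thesis unfolding p E_def a_minus_def using assms c
    by simp (rule frac_eqI, auto simp: R.m_ac R.r_distr R.l_distr R.r_minus R.l_minus)
qed

lemma E_scale1: assumes "s \<in> S" "t \<in> S" "x \<in> carrier L" "r \<in> carrier R" "w \<in> S"
  shows "E (w \<otimes> s) (w \<odot>\<^bsub>L\<^esub> x) t r = E s x t r"
proof -
  have c: "anc x r \<in> carrier R" "anc x t \<in> carrier R" "s \<in> carrier R" "t \<in> carrier R" "w \<in> carrier R" using assms by auto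
  have "anc (w \<odot>\<^bsub>L\<^esub> x) t = w \<otimes> anc x t" "anc (w \<odot>\<^bsub>L\<^esub> x) r = w \<otimes> anc x r" using anc_smult c assms by simp_all
  then show ?thesis unfolding E_def using assms c
    by (intro frac_eqI) (auto simp: R.m_ac R.r_distr R.l_distr R.r_minus R.l_minus)
qed

lemma E_scale2: assumes "s \<in> S" "t \<in> S" "x \<in> carrier L" "r \<in> carrier R" "w \<in> S"
  shows "E s x (w \<otimes> t) (w \<otimes> r) = E s x t r"
proof -
  have c: "anc x r \<in> carrier R" "anc x t \<in> carrier R" "s \<in> carrier R" "t \<in> carrier R" "w \<in> carrier R" "anc x w \<in> carrier R" using assms by auto
  have "w \<otimes> t \<otimes> anc x (w \<otimes> r) \<oplus> \<ominus> (anc x (w \<otimes> t) \<otimes> (w \<otimes> r)) = w \<otimes> w \<otimes> (t \<otimes> anc x r \<oplus> \<ominus> (anc x t \<otimes> r))"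
  proof -
    have rg: "A \<oplus> (B \<oplus> (\<ominus> A \<oplus> C)) = B \<oplus> C" if "A \<in> carrier R" "B \<in> carrier R" "C \<in> carrier R" for A B C
    proof -
      have "A \<oplus> (B \<oplus> (\<ominus> A \<oplus> C)) = (A \<oplus> \<ominus> A) \<oplus> (B \<oplus> C)"
        using that by (simp only: R.a_ac R.a_closed R.a_inv_closed)
      then show ?thesis using that by (simp add: R.r_neg)
    qed
    show ?thesis
      using c assms by (simp add: anc_m R.m_ac R.r_distr R.l_distr R.r_minus R.l_minus R.minus_add R.a_ac rg)
  qed
  then show ?thesis unfolding E_def using assms c
    by (intro frac_eqI) (auto simp: R.m_ac)
qed

lemma local_anchor_eq:
  assumes "s \<in> S" "t \<in> S" "x \<in> carrier L" "r \<in> carrier R"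
  shows "local_anchor R S L anc (mm (recip R S s) x) (recip R S t \<otimes>\<^bsub>Q\<^esub> embed R S r) =
    recip R S s \<otimes>\<^bsub>Q\<^esub> recip R S t \<otimes>\<^bsub>Q\<^esub> embed R S (anc x r)
            \<ominus>\<^bsub>Q\<^esub> recip R S s \<otimes>\<^bsub>Q\<^esub> recip R S t [^]\<^bsub>Q\<^esub> (2::nat) \<otimes>\<^bsub>Q\<^esub> embed R S (anc x t)
              \<otimes>\<^bsub>Q\<^esub> embed R S r"
proof -
  have *: "E s x t r = E s' x' t' r'" if h: "s' \<in> S" "t' \<in> S" "x' \<in> carrier L" "r' \<in> carrier R"
    "mm (recip R S s) x = mm (recip R S s') x'" "recip R S t \<otimes>\<^bsub>Q\<^esub> embed R S r = recip R S t' \<otimes>\<^bsub>Q\<^esub> embed R S r'" for s' t' x' r'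
  proof -
    obtain u where u: "u \<in> S" "u \<odot>\<^bsub>L\<^esub> (s' \<odot>\<^bsub>L\<^esub> x) = u \<odot>\<^bsub>L\<^esub> (s \<odot>\<^bsub>L\<^esub> x')" using mm_recip_eq_iff assms h by blast
    obtain v where v: "v \<in> S" "v \<otimes> (t' \<otimes> r) = v \<otimes> (t \<otimes> r')" using frac_eq[of r r' t t'] assms h by auto
    have "E s x t r = E (u \<otimes> s' \<otimes> s) ((u \<otimes> s') \<odot>\<^bsub>L\<^esub> x) t r" using E_scale1 u assms h by simp
    also have "\<dots> = E (u \<otimes> s \<otimes> s') ((u \<otimes> s) \<odot>\<^bsub>L\<^esub> x') t r"
    proof -
      have "u \<otimes> s' \<otimes> s = u \<otimes> s \<otimes> s'" "(u \<otimes> s') \<odot>\<^bsub>L\<^esub> x = (u \<otimes> s) \<odot>\<^bsub>L\<^esub> x'"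
        using u(1) assms h(1-4) by (simp add: R.m_ac, simp add: L.smult_assoc1 u(2))
      then show ?thesis by simp
    qed
    also have "\<dots> = E s' x' t r" using E_scale1 u assms h by simp
    also have "\<dots> = E s' x' (v \<otimes> t' \<otimes> t) (v \<otimes> t' \<otimes> r)" using E_scale2 v(1) assms h by simp
    also have "\<dots> = E s' x' (v \<otimes> t \<otimes> t') (v \<otimes> t \<otimes> r')"
      using v assms h(1-4) by (simp add: R.m_assoc R.m_comm[of t t'])
    also have "\<dots> = E s' x' t' r'" using E_scale2 v(1) assms h by simp
    finally show ?thesis .
  qed
  show ?thesis unfolding local_anchor_def Let_def
    by (rule the_equality, use assms in blast) (metis * E_eq assms)
qed

end

end

theory Submission
  imports Defs
begin

text \<open>
  In characteristic \<open>p\<close> every derivation kills \<open>p\<close>-th powers, and \<open>1/s = s^(p-1) / s^p\<close>.  So every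
  element of \<open>R_S\<close> and of \<open>L_S\<close> has a denominator from the multiplicative set \<open>C\<close> of those \<open>c \<in> S\<close>
  that are killed by the anchor of every element of \<open>L\<close>, and any two elements have such a denominator
  in common.  On fractions with denominators in \<open>C\<close> all derivative terms vanish: the anchor and the
  bracket are computed on numerators (\<open>lanc_const\<close>, \<open>lbr_const\<close>), and the \<open>p\<close>-th power operation must
  be \<open>(x/c)^[p] = x^[p] / c^p\<close>.  Hence each axiom for the localization is the corresponding axiom
  for \<open>(R, L)\<close> divided by a constant; this includes the addition formula, because the Jacobson terms
  of \<open>x/c\<close> and \<open>y/c\<close> are those of \<open>x\<close> and \<open>y\<close> divided by \<open>c^p\<close> (\<open>jacobson_lfrac\<close>).

  The map \<open>x/c \<mapsto> x^[p] / c^p\<close> is well defined because the formula for \<open>(rx)^[p]\<close> reduces to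
  \<open>(cx)^[p] = c^p x^[p]\<close> for constant \<open>c\<close> (\<open>const_power_well_defined\<close>).  To recover the formula for an
  arbitrary denominator \<open>s\<close> (\<open>lpow_frac\<close>), put \<open>q = s^p\<close> and \<open>y = s^(p-1) x\<close>, so that
  \<open>x/s = y/q\<close>.  Since \<open>sy = qx\<close>, the power \<open>(sy)^[p]\<close> can be computed in two ways:
  as \<open>q^p x^[p]\<close>, because \<open>q\<close> is constant, and as \<open>q y^[p] + (s \<epsilon>(y))^(p-1)(s) y\<close>, where
  \<open>s \<epsilon>(y) = q \<epsilon>(x)\<close>, so that the second term is \<open>q^(p-1) \<epsilon>(x)^(p-1)(s) y\<close>.  Solving for \<open>y^[p] / q^p\<close>
  gives exactly \<open>s^(-p) x^[p] - s^(-p-1) \<epsilon>(x)^(p-1)(s) x\<close>.  The only input about powers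
  of derivations is the formula for \<open>(rx)^[p]\<close> in \<open>(R, L)\<close>, used once for \<open>r = q\<close> and once for \<open>r = s\<close>.
\<close>

section \<open>Multiplication by integers in characteristic p\<close>

context module
begin

lemma nat_multiple_eq_smult:
  assumes "x \<in> carrier M"
  shows "[(n::nat)] \<cdot>\<^bsub>M\<^esub> x = ([n] \<cdot>\<^bsub>R\<^esub> \<one>) \<odot>\<^bsub>M\<^esub> x"
proof (induction n)
  case 0
  have "\<zero> \<odot>\<^bsub>M\<^esub> x = \<zero>\<^bsub>M\<^esub>" using assms smult_l_null by simp
  then show ?case by simp
next
  case (Suc n)
  then show ?case using assms by (simp add: smult_l_distr)
qed

lemma char_multiple_zero:
  assumes "has_characteristic R p" "x \<in> carrier M"
  shows "[(p::nat)] \<cdot>\<^bsub>M\<^esub> x = \<zero>\<^bsub>M\<^esub>"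
proof -
  have "[p] \<cdot>\<^bsub>R\<^esub> \<one> = \<zero>" using assms(1) by (simp add: has_characteristic_def)
  then show ?thesis using nat_multiple_eq_smult[of x p] assms(2) smult_l_null by simp
qed

text \<open>
  An \<open>i\<close> with \<open>0 < i < p\<close> acts invertibly on a module in characteristic \<open>p\<close>; this is what makes the
  Jacobson terms \<open>\<lambda>\<^sub>i\<close> well defined.
\<close>

lemma nat_multiple_inverse:
  assumes "has_characteristic R p" "prime p" "0 < i" "i < p"
  obtains j :: nat where "\<And>x. x \<in> carrier M \<Longrightarrow> [j] \<cdot>\<^bsub>M\<^esub> ([i] \<cdot>\<^bsub>M\<^esub> x) = x"
proof -
  have "coprime i p"
    using assms(2-4) by (metis coprime_commute nat_dvd_not_less prime_imp_coprime)
  then obtain j k where jk: "i * j = p * k + 1"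
    using bezout_nat[of i p] assms(3) by (auto simp: coprime_iff_gcd_eq_1)
  have "[j] \<cdot>\<^bsub>M\<^esub> ([i] \<cdot>\<^bsub>M\<^esub> x) = x" if x: "x \<in> carrier M" for x
  proof -
    have "[j] \<cdot>\<^bsub>M\<^esub> ([i] \<cdot>\<^bsub>M\<^esub> x) = [(p * k + 1)] \<cdot>\<^bsub>M\<^esub> x"
      using M.add.nat_pow_pow[OF x, of j i] jk by (simp add: mult.commute)
    also have "\<dots> = [k] \<cdot>\<^bsub>M\<^esub> ([p] \<cdot>\<^bsub>M\<^esub> x) \<oplus>\<^bsub>M\<^esub> x"
      using M.add.nat_pow_pow[OF x, of k p] x by (simp add: M.add.nat_pow_mult[symmetric] mult.commute)
    finally show ?thesis using char_multiple_zero[OF assms(1) x] x by simp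
  qed
  then show thesis by (rule that)
qed

end

section \<open>Restriction of scalars\<close>

lemma restrict_scalars_simps [simp]:
  "carrier (restrict_scalars A M) = carrier M" "add (restrict_scalars A M) = add M"
  "ring.zero (restrict_scalars A M) = ring.zero M"
  "c \<odot>\<^bsub>restrict_scalars A M\<^esub> x = (c \<odot>\<^bsub>A\<^esub> \<one>\<^bsub>A\<^esub>) \<odot>\<^bsub>M\<^esub> x"
  by (simp_all add: restrict_scalars_def)

lemma restrict_scalars_add_pow [simp]: "[(n::nat)] \<cdot>\<^bsub>restrict_scalars A M\<^esub> x = [n] \<cdot>\<^bsub>M\<^esub> x"
  by (induction n) (simp_all add: add_pow_def nat_pow_def)

text \<open>
  The sums are folds over commutative monoids whose record types differ, so they are compared by
  induction on the index set.
\<close>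

lemma restrict_scalars_finsum:
  assumes "abelian_group (restrict_scalars A M)" "abelian_group M" "finite I" "f \<in> I \<rightarrow> carrier M"
  shows "finsum (restrict_scalars A M) f I = finsum M f I"
proof -
  interpret A: abelian_group "restrict_scalars A M" by fact
  interpret M: abelian_group M by fact
  show ?thesis
    using assms(3,4)
  proof (induction I rule: finite_induct)
    case (insert i I)
    then have "f \<in> I \<rightarrow> carrier M" "f i \<in> carrier M" by auto
    then show ?case using insert by simp
  qed simp
qed

lemma restrict_scalars_module:
  assumes "algebra K A" "module A M"
  shows "module K (restrict_scalars A M)"
proof -
  interpret A: algebra K A by fact
  interpret M: module A M by fact
  have "abelian_group (restrict_scalars A M)"
    by (rule abelian_groupI) (simp_all add: M.M.a_ac M.M.add.l_inv_ex)
  then show ?thesis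
  proof (rule moduleI[OF A.R.is_cring], goal_cases)
    case (4 a b x)
    have "(a \<otimes>\<^bsub>K\<^esub> b) \<odot>\<^bsub>A\<^esub> \<one>\<^bsub>A\<^esub> = (a \<odot>\<^bsub>A\<^esub> \<one>\<^bsub>A\<^esub>) \<otimes>\<^bsub>A\<^esub> (b \<odot>\<^bsub>A\<^esub> \<one>\<^bsub>A\<^esub>)"
      using 4 by (simp add: A.smult_assoc1 A.smult_assoc2)
    then show ?case using 4 by (simp add: M.smult_assoc1)
  qed (simp_all add: M.smult_l_distr M.smult_r_distr A.smult_l_distr)
qed

section \<open>The Jacobson terms\<close>

context lie_algebra
begin

lemma poly_bracket_closed:
  assumes "\<And>n. f n \<in> carrier M" "\<And>n. g n \<in> carrier M"
  shows "poly_bracket M br f g n \<in> carrier M"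
  unfolding poly_bracket_def by (rule M.finsum_closed) (use assms br_closed in auto)

lemma poly_bracket_power_closed:
  assumes "\<And>n. f n \<in> carrier M" "\<And>n. g n \<in> carrier M"
  shows "(poly_bracket M br f ^^ k) g n \<in> carrier M"
  by (induction k arbitrary: n) (simp_all add: assms poly_bracket_closed)

lemma jacobson_coeff_closed:
  assumes "x \<in> carrier M" "y \<in> carrier M"
  shows "jacobson_coeff M br p x y n \<in> carrier M"
  unfolding jacobson_coeff_def by (rule poly_bracket_power_closed) (use assms in auto)

lemma jacobson_characterization:
  assumes "has_characteristic K p" "prime p" "0 < i" "i < p"
    and "x \<in> carrier M" "y \<in> carrier M"
  shows "z = jacobson M br p i x y \<longleftrightarrow>
    z \<in> carrier M \<and> [i] \<cdot>\<^bsub>M\<^esub> z = jacobson_coeff M br p x y (i - 1)"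
proof -
  let ?c = "jacobson_coeff M br p x y (i - 1)"
  obtain j :: nat where j: "\<And>z. z \<in> carrier M \<Longrightarrow> [j] \<cdot>\<^bsub>M\<^esub> ([i] \<cdot>\<^bsub>M\<^esub> z) = z"
    using nat_multiple_inverse assms(1-4) by blast
  have c: "?c \<in> carrier M" by (rule jacobson_coeff_closed) fact+
  have "[i] \<cdot>\<^bsub>M\<^esub> ([j] \<cdot>\<^bsub>M\<^esub> ?c) = ?c"
    using j[OF c] M.add.nat_pow_pow[OF c] by (simp add: mult.commute)
  then have "\<exists>!z. z \<in> carrier M \<and> [i] \<cdot>\<^bsub>M\<^esub> z = ?c"
    by (intro ex1I[of _ "[j] \<cdot>\<^bsub>M\<^esub> ?c"]) (use c in simp, use j in metis)
  from theI'[OF this] this show ?thesis unfolding jacobson_def by blast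
qed

end

section \<open>Fractions with constant denominators\<close>

locale restricted_localization =
  restricted_lie_rinehart K R L br anc p P + lie_rinehart_localization K R L br anc S
  for K :: "('k, 'c) ring_scheme" and R :: "('k, 'r, 'd) module_scheme" (structure)
    and L :: "('r, 'l, 'e) module_scheme" and br anc p P S
begin

abbreviation lfrac where "lfrac x s \<equiv> mfrac R S L (recip R S s) x"

abbreviation "lbr \<equiv> local_bracket R S L br anc"
abbreviation "lanc \<equiv> local_anchor R S L anc"

lemma S_pow [simp]: "s \<in> S \<Longrightarrow> s [^] (n::nat) \<in> S"
  by (induction n) simp_all

lemma anc_zero [simp]: "x \<in> carrier L \<Longrightarrow> anc x \<zero> = \<zero>"
  using anc_m[of x \<zero> \<zero>] by simp

lemma anc_pow:
  assumes "x \<in> carrier L" "a \<in> carrier R"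
  shows "anc x (a [^] Suc n) = [Suc n] \<cdot> (a [^] n \<otimes> anc x a)"
proof (induction n)
  case 0
  then show ?case using assms by simp
next
  case (Suc n)
  have c: "anc x a \<in> carrier R" "a [^] n \<in> carrier R" using assms by auto
  have "anc x (a [^] Suc (Suc n)) = a [^] Suc n \<otimes> anc x a \<oplus> anc x (a [^] Suc n) \<otimes> a"
    using anc_m[of x "a [^] Suc n" a] assms by simp
  also have "anc x (a [^] Suc n) \<otimes> a = [Suc n] \<cdot> (a [^] Suc n \<otimes> anc x a)"
    unfolding Suc.IH using c assms(2)
    by (subst R.add_pow_ldistr) (simp_all add: R.m_ac)
  finally show ?case using c assms(2) by (simp add: R.a_comm)
qed

text \<open>Division by an element of \<open>C\<close> commutes with the anchors and with the bracket.\<close>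

definition C where "C = {c \<in> S. \<forall>x\<in>carrier L. anc x c = \<zero>}"

lemma CI: "\<lbrakk>c \<in> S; \<And>x. x \<in> carrier L \<Longrightarrow> anc x c = \<zero>\<rbrakk> \<Longrightarrow> c \<in> C"
  by (simp add: C_def)

lemma C_S [simp]: "c \<in> C \<Longrightarrow> c \<in> S"
  and anc_C [simp]: "\<lbrakk>c \<in> C; x \<in> carrier L\<rbrakk> \<Longrightarrow> anc x c = \<zero>"
  by (simp_all add: C_def)

lemma C_mult [simp]: "\<lbrakk>c \<in> C; d \<in> C\<rbrakk> \<Longrightarrow> c \<otimes> d \<in> C"
  by (rule CI) (simp_all add: anc_m)

lemma C_p_power [simp]:
  assumes "s \<in> S" shows "s [^] p \<in> C"
proof -
  have "anc x (s [^] p) = \<zero>" if "x \<in> carrier L" for x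
  proof -
    obtain n where n: "p = Suc n" using prime_gt_0_nat[OF Lie.prime_p] by (cases p) simp_all
    have "s [^] n \<otimes> anc x s \<in> carrier R" using that assms by simp
    then have "[p] \<cdot> (s [^] n \<otimes> anc x s) = \<zero>" by (rule R.char_multiple_zero[OF Lie.char_p])
    then show ?thesis using anc_pow[of x s n] that S_carr[OF assms] unfolding n by argo
  qed
  then show ?thesis using assms by (intro CI) simp_all
qed

lemma C_one [simp]: "\<one> \<in> C"
  using C_p_power[OF one_S] by (simp only: R.nat_pow_one)

lemma C_pow [simp]: "c \<in> C \<Longrightarrow> c [^] (n::nat) \<in> C"
  by (induction n) simp_all

lemma p_power_split: "s \<in> carrier R \<Longrightarrow> s [^] p = s \<otimes> s [^] (p - 1)"
  using prime_gt_0_nat[OF Lie.prime_p] by (cases p) (simp_all add: R.m_comm)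

lemma lfrac_scale:
  "\<lbrakk>x \<in> carrier L; s \<in> S; u \<in> S\<rbrakk> \<Longrightarrow> lfrac (u \<odot>\<^bsub>L\<^esub> x) (u \<otimes> s) = lfrac x s"
  using one_S mm_recip_eq_iff[of "u \<odot>\<^bsub>L\<^esub> x" x "u \<otimes> s" s]
  by (auto simp: L.smult_assoc1[symmetric] R.m_ac intro!: bexI[of _ \<one>])

lemma lfrac_scale':
  "\<lbrakk>x \<in> carrier L; s \<in> S; u \<in> S\<rbrakk> \<Longrightarrow> lfrac (u \<odot>\<^bsub>L\<^esub> x) (s \<otimes> u) = lfrac x s"
  using lfrac_scale by (simp add: R.m_comm)

lemma frac_scale:
  "\<lbrakk>r \<in> carrier R; s \<in> S; u \<in> S\<rbrakk> \<Longrightarrow> frac R S (u \<otimes> r) (u \<otimes> s) = frac R S r s"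
  by (rule frac_eqI) (auto simp: R.m_ac)

text \<open>Expanding \<open>x/s\<close> by \<open>s^(p-1)\<close> makes the denominator a \<open>p\<close>-th power, hence a constant.\<close>

lemma T_const_cases:
  assumes "X \<in> carrier T"
  obtains c x where "c \<in> C" "x \<in> carrier L" "X = lfrac x c"
proof -
  obtain s x where s: "s \<in> S" "x \<in> carrier L" "X = lfrac x s" using assms T_cases by metis
  have "X = lfrac (s [^] (p - 1) \<odot>\<^bsub>L\<^esub> x) (s [^] p)"
    using lfrac_scale'[of x s "s [^] (p - 1)"] s by (simp add: p_power_split)
  then show thesis by (rule that[rotated 2]) (use s in simp_all)
qed

lemma Q_const_cases:
  assumes "A \<in> carrier Q"
  obtains c r where "c \<in> C" "r \<in> carrier R" "A = frac R S r c"
proof -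
  obtain r s where s: "r \<in> carrier R" "s \<in> S" "A = frac R S r s" using assms frac_cases by metis
  have "A = frac R S (s [^] (p - 1) \<otimes> r) (s [^] p)"
    using frac_scale[of r s "s [^] (p - 1)"] s by (simp add: p_power_split R.m_comm)
  then show thesis by (rule that[rotated 2]) (use s in simp_all)
qed

lemma T_common_denominator:
  assumes "X \<in> carrier T" "Y \<in> carrier T"
  obtains c x y where "c \<in> C" "x \<in> carrier L" "y \<in> carrier L" "X = lfrac x c" "Y = lfrac y c"
proof -
  obtain c x where c: "c \<in> C" "x \<in> carrier L" "X = lfrac x c" using assms T_const_cases by metis
  obtain d y where d: "d \<in> C" "y \<in> carrier L" "Y = lfrac y d" using assms T_const_cases by metis
  have "X = lfrac (d \<odot>\<^bsub>L\<^esub> x) (c \<otimes> d)" "Y = lfrac (c \<odot>\<^bsub>L\<^esub> y) (c \<otimes> d)"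
    using c d by (simp_all add: lfrac_scale lfrac_scale')
  then show thesis by (rule that[rotated 3]) (use c d in simp_all)
qed

lemma lfrac_closed [simp]: "\<lbrakk>x \<in> carrier L; s \<in> S\<rbrakk> \<Longrightarrow> lfrac x s \<in> carrier T"
  by simp

lemma lfrac_add [simp]:
  "\<lbrakk>x \<in> carrier L; y \<in> carrier L; s \<in> S\<rbrakk> \<Longrightarrow> lfrac x s \<oplus>\<^bsub>T\<^esub> lfrac y s = lfrac (x \<oplus>\<^bsub>L\<^esub> y) s"
  by (simp add: mm_add2)

lemma lfrac_zero [simp]:
  assumes "s \<in> S" shows "lfrac \<zero>\<^bsub>L\<^esub> s = \<zero>\<^bsub>T\<^esub>"
proof -
  have c: "lfrac \<zero>\<^bsub>L\<^esub> s \<in> carrier T" using assms by simp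
  have "lfrac \<zero>\<^bsub>L\<^esub> s \<oplus>\<^bsub>T\<^esub> lfrac \<zero>\<^bsub>L\<^esub> s = lfrac \<zero>\<^bsub>L\<^esub> s" using assms by (subst lfrac_add) simp_all
  then show ?thesis using T.add.r_cancel_one[OF c c] by blast
qed

lemma lfrac_smult [simp]:
  "\<lbrakk>r \<in> carrier R; x \<in> carrier L; s \<in> S; t \<in> S\<rbrakk> \<Longrightarrow>
    frac R S r s \<odot>\<^bsub>T\<^esub> lfrac x t = lfrac (r \<odot>\<^bsub>L\<^esub> x) (s \<otimes> t)"
  using smult_frag[of "frac R S r s" "recip R S t" x] mm_frac[of r "s \<otimes> t" x] by simp

lemma lfrac_finsum:
  assumes "finite I" "\<And>i. i \<in> I \<Longrightarrow> f i \<in> carrier L" "s \<in> S"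
  shows "(\<Oplus>\<^bsub>T\<^esub>i\<in>I. lfrac (f i) s) = lfrac (\<Oplus>\<^bsub>L\<^esub>i\<in>I. f i) s"
  using assms(1,2)
proof (induction I rule: finite_induct)
  case empty
  then show ?case using assms(3) by simp
next
  case (insert i I)
  have "(\<lambda>i. lfrac (f i) s) \<in> I \<rightarrow> carrier T" "f \<in> I \<rightarrow> carrier L"
    using insert.prems assms(3) by auto
  then show ?case using insert assms(3) by simp
qed

lemma lfrac_add_pow:
  assumes "x \<in> carrier L" "s \<in> S"
  shows "[(n::nat)] \<cdot>\<^bsub>T\<^esub> lfrac x s = lfrac ([n] \<cdot>\<^bsub>L\<^esub> x) s"
  using assms by (induction n) simp_all

lemma lbr_const [simp]:
  assumes "c \<in> C" "d \<in> C" "x \<in> carrier L" "y \<in> carrier L"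
  shows "lbr (lfrac x c) (lfrac y d) = lfrac (br x y) (c \<otimes> d)"
proof -
  have z: "mm (frac R S \<zero> u) z = \<zero>\<^bsub>T\<^esub>" if "u \<in> S" "z \<in> carrier L" for u z
    using that mm_frac[of \<zero> u z] by (simp add: L.smult_l_null)
  have "lbr (lfrac x c) (lfrac y d) = Z c x d y"
    using local_bracket_eq[of c d x y] Z_eq[of c d x y] assms C_S by metis
  then show ?thesis using assms by (simp add: Z_def z)
qed

lemma lanc_const [simp]:
  assumes "c \<in> C" "d \<in> C" "x \<in> carrier L" "r \<in> carrier R"
  shows "lanc (lfrac x c) (frac R S r d) = frac R S (anc x r) (c \<otimes> d)"
proof -
  have "lanc (lfrac x c) (frac R S r d) = E c x d r"
    using local_anchor_eq[of c d x r] E_eq[of c d x r] frac_mult[of \<one> r d \<one>] assms by simp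
  also have "\<dots> = frac R S (anc x r) (c \<otimes> d)"
    unfolding E_def using assms by (intro frac_eqI) (auto simp: R.m_ac)
  finally show ?thesis .
qed


section \<open>The localized Lie-Rinehart algebra\<close>

lemma T_module: "module Q T"
proof (rule moduleI[OF Q_cring T_abelian], goal_cases)
  case (1 A X)
  then obtain s x where "s \<in> S" "x \<in> carrier L" "X = lfrac x s" using T_cases by metis
  then show ?case using 1 by (simp add: smult_frag)
next
  case (2 A B X)
  then obtain s x where X: "s \<in> S" "x \<in> carrier L" "X = lfrac x s" using T_cases by metis
  then show ?case using 2 by (simp add: smult_frag F.Q.l_distr mm_add1)
next
  case (3 A X Y)
  then obtain c x y where X: "c \<in> C" "x \<in> carrier L" "y \<in> carrier L" "X = lfrac x c" "Y = lfrac y c"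
    using T_common_denominator by metis
  then show ?case using 3(1) by (simp add: smult_frag mm_add2[symmetric])
next
  case (4 A B X)
  then obtain s x where X: "s \<in> S" "x \<in> carrier L" "X = lfrac x s" using T_cases by metis
  then show ?case using 4 by (simp add: smult_frag F.Q.m_assoc)
next
  case (5 X)
  then obtain s x where X: "s \<in> S" "x \<in> carrier L" "X = lfrac x s" using T_cases by metis
  then show ?case by (simp add: smult_frag)
qed

lemma Q_smult [simp]:
  assumes "k \<in> carrier K" "r \<in> carrier R" "s \<in> S"
  shows "k \<odot>\<^bsub>Q\<^esub> frac R S r s = frac R S (k \<odot> r) s"
proof -
  have wd: "frac R S (k \<odot> a) c = frac R S (k \<odot> r) s" if h: "(a, c) \<in> frac R S r s" for a c
  proof -
    obtain u where u: "u \<in> S" "u \<otimes> (c \<otimes> r) = u \<otimes> (s \<otimes> a)" "a \<in> carrier R" "c \<in> S"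
      using h by (auto simp: frac_def)
    have k: "k \<odot> b = (k \<odot> \<one>) \<otimes> b" if "b \<in> carrier R" for b
      using that assms by (simp add: R.smult_assoc2)
    have "u \<otimes> (c \<otimes> (k \<odot> r)) = (k \<odot> \<one>) \<otimes> (u \<otimes> (c \<otimes> r))"
      using assms u(1,3,4) by (subst k) (simp_all add: R.m_ac del: R.smult_assoc2)
    also have "\<dots> = u \<otimes> (s \<otimes> (k \<odot> a))"
      unfolding u(2) using assms u(1,3,4) by (subst k[of a]) (simp_all add: R.m_ac del: R.smult_assoc2)
    finally show ?thesis
      using u(1,3,4) assms by (subst frac_eq) (auto intro!: bexI[of _ u] simp del: R.smult_assoc2)
  qed
  have n: "(r, s) \<in> frac R S r s" using assms by (simp add: frac_mf F.mf_self)
  have "k \<odot>\<^bsub>Q\<^esub> frac R S r s = (\<Union>(a, c)\<in>frac R S r s. frac R S (k \<odot> a) c)"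
    by (simp add: localization_def)
  also have "\<dots> = frac R S (k \<odot> r) s"
    using n wd by (intro UN_const) blast+
  finally show ?thesis .
qed

lemma frac_add_same:
  assumes "r \<in> carrier R" "r' \<in> carrier R" "s \<in> S"
  shows "frac R S r s \<oplus>\<^bsub>Q\<^esub> frac R S r' s = frac R S (r \<oplus> r') s"
  using assms frac_scale[of "r \<oplus> r'" s s] by (simp add: R.r_distr)

lemma frac_minus_same:
  assumes "r \<in> carrier R" "r' \<in> carrier R" "s \<in> S"
  shows "frac R S r s \<ominus>\<^bsub>Q\<^esub> frac R S r' s = frac R S (r \<ominus> r') s"
  using assms frac_add_same[of r "\<ominus> r'" s] by (simp add: a_minus_def)

text \<open>
  Scalars act through the ring homomorphism from \<open>K\<close> to the localized ring that sends \<open>k\<close> to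
  \<open>(k 1)/1\<close>, so the algebra laws are ring laws.
\<close>

lemma Q_algebra: "algebra K Q"
proof -
  let ?e = "\<lambda>k. embed R S (k \<odot> \<one>)"
  have e: "k \<odot>\<^bsub>Q\<^esub> A = ?e k \<otimes>\<^bsub>Q\<^esub> A" if k: "k \<in> carrier K" and A: "A \<in> carrier Q" for k A
  proof -
    obtain r s where "r \<in> carrier R" "s \<in> S" "A = frac R S r s" using A frac_cases by metis
    then show ?thesis using k by (simp add: R.smult_assoc2)
  qed
  have ec: "?e k \<in> carrier Q" if "k \<in> carrier K" for k using that by simp
  have e_add: "?e (k \<oplus>\<^bsub>K\<^esub> l) = ?e k \<oplus>\<^bsub>Q\<^esub> ?e l" if "k \<in> carrier K" "l \<in> carrier K" for k l
    using that by (simp add: R.smult_l_distr)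
  have e_mult: "?e (k \<otimes>\<^bsub>K\<^esub> l) = ?e k \<otimes>\<^bsub>Q\<^esub> ?e l" if "k \<in> carrier K" "l \<in> carrier K" for k l
    using that by (simp add: R.smult_assoc1 R.smult_assoc2)
  have e_one: "embed R S \<one> \<otimes>\<^bsub>Q\<^esub> A = A" if "A \<in> carrier Q" for A
    using that F.Q.l_one by (simp add: Q_one)
  show ?thesis
    by (rule algebraI[OF R.R.is_cring Q_cring])
      (simp_all add: e ec e_add e_mult e_one F.Q.l_distr F.Q.r_distr F.Q.m_assoc
        del: frac_mult frac_add)
qed

lemma scalar_lfrac:
  assumes "k \<in> carrier K" "x \<in> carrier L" "s \<in> S"
  shows "(k \<odot>\<^bsub>Q\<^esub> \<one>\<^bsub>Q\<^esub>) \<odot>\<^bsub>T\<^esub> lfrac x s = lfrac ((k \<odot> \<one>) \<odot>\<^bsub>L\<^esub> x) s"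
  using assms by (simp add: Q_one)

lemma P_closed [simp]: "x \<in> carrier L \<Longrightarrow> P x \<in> carrier L"
  using Lie.P_closed by simp

text \<open>
  Over constant denominators every Lie identity is an identity of numerators, divided by the product
  of the denominators; the same holds for the anchor below.
\<close>

lemma T_lie_algebra: "lie_algebra K (restrict_scalars Q T) lbr"
proof (rule lie_algebra.intro[OF restrict_scalars_module[OF Q_algebra T_module]],
    unfold_locales, unfold restrict_scalars_simps, goal_cases)
  case (1 X Y)
  then show ?case by (elim T_const_cases) simp
next
  case (2 X Y Z)
  obtain c x y where X: "c \<in> C" "x \<in> carrier L" "y \<in> carrier L" "X = lfrac x c" "Y = lfrac y c"
    using 2 T_common_denominator by metis
  obtain d z where Z: "d \<in> C" "z \<in> carrier L" "Z = lfrac z d" using 2 T_const_cases by metis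
  show ?case using X Z Lie.br_add_left[of x y z] by simp
next
  case (3 X Y Z)
  obtain c y z where Y: "c \<in> C" "y \<in> carrier L" "z \<in> carrier L" "Y = lfrac y c" "Z = lfrac z c"
    using 3 T_common_denominator by metis
  obtain d x where X: "d \<in> C" "x \<in> carrier L" "X = lfrac x d" using 3 T_const_cases by metis
  show ?case using X Y Lie.br_add_right[of x y z] by simp
next
  case (4 k X Y)
  obtain c x where X: "c \<in> C" "x \<in> carrier L" "X = lfrac x c" using 4 T_const_cases by metis
  obtain d y where Y: "d \<in> C" "y \<in> carrier L" "Y = lfrac y d" using 4 T_const_cases by metis
  show ?case using X Y 4(1) Lie.br_smult_left[of k x y] by (simp add: scalar_lfrac)
next
  case (5 k X Y)
  obtain c x where X: "c \<in> C" "x \<in> carrier L" "X = lfrac x c" using 5 T_const_cases by metis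
  obtain d y where Y: "d \<in> C" "y \<in> carrier L" "Y = lfrac y d" using 5 T_const_cases by metis
  show ?case using X Y 5(1) Lie.br_smult_right[of k x y] by (simp add: scalar_lfrac)
next
  case (6 X)
  obtain c x where X: "c \<in> C" "x \<in> carrier L" "X = lfrac x c" using 6 T_const_cases by metis
  then show ?case using Lie.br_self[of x] by simp
next
  case (7 X Y Z)
  obtain c x where X: "c \<in> C" "x \<in> carrier L" "X = lfrac x c" using 7 T_const_cases by metis
  obtain d y where Y: "d \<in> C" "y \<in> carrier L" "Y = lfrac y d" using 7 T_const_cases by metis
  obtain e z where Z: "e \<in> C" "z \<in> carrier L" "Z = lfrac z e" using 7 T_const_cases by metis
  show ?case using X Y Z Lie.jacobi[of x y z] by (simp add: R.m_ac)
qed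

lemma lanc_derivation:
  assumes "X \<in> carrier T" shows "lanc X \<in> derivations K Q"
proof -
  obtain c x where X: "c \<in> C" "x \<in> carrier L" "X = lfrac x c" using assms T_const_cases by metis
  have D: "anc x (r \<oplus> r') = anc x r \<oplus> anc x r'" "k \<in> carrier K \<Longrightarrow> anc x (k \<odot> r) = k \<odot> anc x r"
    if "r \<in> carrier R" "r' \<in> carrier R" for r r' k
    using anc_derivation[OF X(2)] that by (auto simp: derivations_def)
  show ?thesis unfolding derivations_def
  proof (intro CollectI conjI ballI funcsetI, goal_cases)
    case (1 A)
    then obtain d r where A: "d \<in> C" "r \<in> carrier R" "A = frac R S r d" using Q_const_cases by metis
    then show ?case using X by simp
  next
    case (2 A B)
    obtain d r where A: "d \<in> C" "r \<in> carrier R" "A = frac R S r d" using 2 Q_const_cases by metis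
    obtain e r' where B: "e \<in> C" "r' \<in> carrier R" "B = frac R S r' e" using 2 Q_const_cases by metis
    have "A = frac R S (e \<otimes> r) (d \<otimes> e)" "B = frac R S (d \<otimes> r') (d \<otimes> e)"
      using A B frac_scale[of r d e] frac_scale[of r' e d] by (simp_all add: R.m_comm[of d e])
    then show ?case using A B X
      by (simp add: frac_add_same D del: frac_add)
  next
    case (3 k A)
    then obtain d r where A: "d \<in> C" "r \<in> carrier R" "A = frac R S r d" using Q_const_cases by metis
    then show ?case using X 3(1) D(2) by simp
  next
    case (4 A B)
    obtain d r where A: "d \<in> C" "r \<in> carrier R" "A = frac R S r d" using 4 Q_const_cases by metis
    obtain e r' where B: "e \<in> C" "r' \<in> carrier R" "B = frac R S r' e" using 4 Q_const_cases by metis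
    have den: "d \<otimes> (c \<otimes> e) = c \<otimes> (d \<otimes> e)" "c \<otimes> d \<otimes> e = c \<otimes> (d \<otimes> e)"
      using A B X by (simp_all add: R.m_ac)
    show ?case using A B X by (simp add: den frac_add_same anc_m del: frac_add)
  qed
qed

lemma T_lie_rinehart: "lie_rinehart K Q T lbr lanc"
proof (rule lie_rinehart.intro[OF Q_algebra T_module T_lie_algebra], unfold_locales, goal_cases)
  case (1 X)
  then show ?case by (rule lanc_derivation)
next
  case (2 X Y A)
  obtain c x y where X: "c \<in> C" "x \<in> carrier L" "y \<in> carrier L" "X = lfrac x c" "Y = lfrac y c"
    using 2 T_common_denominator by metis
  obtain d r where A: "d \<in> C" "r \<in> carrier R" "A = frac R S r d" using 2 Q_const_cases by metis
  show ?case using X A by (simp add: frac_add_same anc_add del: frac_add)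
next
  case (3 B X A)
  obtain c x where X: "c \<in> C" "x \<in> carrier L" "X = lfrac x c" using 3 T_const_cases by metis
  obtain d r where A: "d \<in> C" "r \<in> carrier R" "A = frac R S r d" using 3 Q_const_cases by metis
  obtain e r' where B: "e \<in> C" "r' \<in> carrier R" "B = frac R S r' e" using 3 Q_const_cases by metis
  show ?case using X A B by (simp add: anc_smult R.m_assoc)
next
  case (4 X Y A)
  obtain c x where X: "c \<in> C" "x \<in> carrier L" "X = lfrac x c" using 4 T_const_cases by metis
  obtain d y where Y: "d \<in> C" "y \<in> carrier L" "Y = lfrac y d" using 4 T_const_cases by metis
  obtain e r where A: "e \<in> C" "r \<in> carrier R" "A = frac R S r e" using 4 Q_const_cases by metis
  have den: "c \<otimes> (d \<otimes> e) = c \<otimes> d \<otimes> e" "d \<otimes> (c \<otimes> e) = c \<otimes> d \<otimes> e"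
    using X Y A by (simp_all add: R.m_ac)
  show ?case using X Y A by (simp add: den frac_minus_same anc_br)
next
  case (5 X Y A)
  obtain c x where X: "c \<in> C" "x \<in> carrier L" "X = lfrac x c" using 5 T_const_cases by metis
  obtain d y where Y: "d \<in> C" "y \<in> carrier L" "Y = lfrac y d" using 5 T_const_cases by metis
  obtain e r where A: "e \<in> C" "r \<in> carrier R" "A = frac R S r e" using 5 Q_const_cases by metis
  show ?case using X Y A by (simp add: br_leibniz R.m_ac)
qed


section \<open>The localized p-th power\<close>

lemma scaled_anchor_power:
  assumes "c \<in> C" "x \<in> carrier L" "a \<in> carrier R"
  shows "((\<lambda>a. c \<otimes> anc x a) ^^ n) a = c [^] n \<otimes> (anc x ^^ n) a"
    and "(anc x ^^ n) a \<in> carrier R"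
proof -
  have "((\<lambda>a. c \<otimes> anc x a) ^^ n) a = c [^] n \<otimes> (anc x ^^ n) a \<and> (anc x ^^ n) a \<in> carrier R"
    using assms by (induction n) (simp_all add: anc_m R.m_ac)
  then show "((\<lambda>a. c \<otimes> anc x a) ^^ n) a = c [^] n \<otimes> (anc x ^^ n) a"
    and "(anc x ^^ n) a \<in> carrier R" by blast+
qed

text \<open>
  Here \<open>p - 1 \<ge> 1\<close> matters: the correction term \<open>(c \<epsilon>(x))^(p-1)(c)\<close> applies a derivation to \<open>c\<close> at
  least once, so it vanishes.
\<close>

lemma P_const:
  assumes "c \<in> C" "x \<in> carrier L"
  shows "P (c \<odot>\<^bsub>L\<^esub> x) = c [^] p \<odot>\<^bsub>L\<^esub> P x"
proof -
  obtain n where n: "p - 1 = Suc n"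
    using prime_gt_1_nat[OF Lie.prime_p] by (cases "p - 1") simp_all
  have "(anc x ^^ k) \<zero> = \<zero>" for k using assms by (induction k) simp_all
  then have "(anc x ^^ (p - 1)) c = \<zero>" unfolding n funpow_Suc_right using assms by simp
  then show ?thesis
    using P_smult_R[of c x] scaled_anchor_power[of c x c "p - 1"] assms by (simp add: L.smult_l_null)
qed

text \<open>
  Equality of two fractions is witnessed by some \<open>u \<in> S\<close>.  Multiplying by \<open>u^(p-1)\<close> replaces \<open>u\<close> by
  the constant \<open>u^p\<close>, which passes through the \<open>p\<close>-th power map.
\<close>

lemma const_power_well_defined:
  assumes "c \<in> C" "d \<in> C" "x \<in> carrier L" "y \<in> carrier L" "lfrac x c = lfrac y d"
  shows "lfrac (P x) (c [^] p) = lfrac (P y) (d [^] p)"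
proof -
  obtain u where u: "u \<in> S" "u \<odot>\<^bsub>L\<^esub> (d \<odot>\<^bsub>L\<^esub> x) = u \<odot>\<^bsub>L\<^esub> (c \<odot>\<^bsub>L\<^esub> y)"
    using assms mm_recip_eq_iff[of x y c d] by auto
  let ?v = "u [^] p"
  have "(?v \<otimes> d) \<odot>\<^bsub>L\<^esub> x = u [^] (p - 1) \<odot>\<^bsub>L\<^esub> (u \<odot>\<^bsub>L\<^esub> (d \<odot>\<^bsub>L\<^esub> x))"
    using u(1) assms(1-4) by (simp add: p_power_split L.smult_assoc1[symmetric] R.m_ac)
  also have "\<dots> = (?v \<otimes> c) \<odot>\<^bsub>L\<^esub> y"
    unfolding u(2) using u(1) assms(1-4)
    by (simp add: p_power_split L.smult_assoc1[symmetric] R.m_ac)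
  finally have "P ((?v \<otimes> d) \<odot>\<^bsub>L\<^esub> x) = P ((?v \<otimes> c) \<odot>\<^bsub>L\<^esub> y)" by simp
  then have "?v [^] p \<odot>\<^bsub>L\<^esub> (d [^] p \<odot>\<^bsub>L\<^esub> P x) = ?v [^] p \<odot>\<^bsub>L\<^esub> (c [^] p \<odot>\<^bsub>L\<^esub> P y)"
    using u(1) assms(1-4) by (simp add: P_const R.nat_pow_distrib L.smult_assoc1)
  then show ?thesis
    using u(1) assms(1-4) by (subst mm_recip_eq_iff) (auto intro!: bexI[of _ "?v [^] p"])
qed

definition lpow where
  "lpow X = (THE Z. \<exists>c\<in>C. \<exists>x\<in>carrier L. X = lfrac x c \<and> Z = lfrac (P x) (c [^] p))"

lemma lpow_const:
  assumes "c \<in> C" "x \<in> carrier L"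
  shows "lpow (lfrac x c) = lfrac (P x) (c [^] p)"
  unfolding lpow_def
proof (rule the_equality)
  show "\<exists>d\<in>C. \<exists>y\<in>carrier L. lfrac x c = lfrac y d \<and> lfrac (P x) (c [^] p) = lfrac (P y) (d [^] p)"
    using assms by blast
qed (metis assms const_power_well_defined)

lemma frac_pow:
  assumes "r \<in> carrier R" "s \<in> S"
  shows "frac R S r s [^]\<^bsub>Q\<^esub> (n::nat) = frac R S (r [^] n) (s [^] n)"
  using assms by (induction n) (simp_all add: Q_one)

text \<open>
  The formula for an arbitrary denominator comes from evaluating \<open>(s y)^[p] = (s^p x)^[p]\<close> in two
  ways, where \<open>y = s^(p-1) x\<close>.
\<close>

lemma lpow_frac:
  assumes "s \<in> S" "x \<in> carrier L"
  shows "lpow (lfrac x s) = mm (recip R S s [^]\<^bsub>Q\<^esub> p) (P x)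
    \<ominus>\<^bsub>T\<^esub> mm (recip R S s [^]\<^bsub>Q\<^esub> (p + 1) \<otimes>\<^bsub>Q\<^esub> embed R S ((anc x ^^ (p - 1)) s)) x"
proof -
  define q where "q = s [^] p"
  define t where "t = s [^] (p - 1)"
  define D where "D = (anc x ^^ (p - 1)) s"
  define y where "y = t \<odot>\<^bsub>L\<^esub> x"
  have q: "q \<in> C" "q = s \<otimes> t"
    using assms C_p_power[of s] p_power_split[of s] by (simp_all add: q_def t_def)
  have t: "t \<in> S" using assms by (simp add: t_def)
  have s: "s \<in> S" "s \<in> carrier R" "x \<in> carrier L" using assms by simp_all
  have y: "y \<in> carrier L" using s t by (simp add: y_def)
  have D: "D \<in> carrier R"
    unfolding D_def using scaled_anchor_power(2)[of \<one> x s] s by simp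
  have lhs: "lpow (lfrac x s) = lfrac (P y) (q [^] p)"
    using lpow_const[OF q(1) y] lfrac_scale'[of x s t] s t by (simp add: y_def q(2))
  define w where "w = (q [^] (p - 1) \<otimes> t) \<odot>\<^bsub>L\<^esub> (D \<odot>\<^bsub>L\<^esub> x)"
  have w: "w \<in> carrier L" using D q(1) s t by (simp add: w_def)
  have key: "q [^] p \<odot>\<^bsub>L\<^esub> P x = q \<odot>\<^bsub>L\<^esub> P y \<oplus>\<^bsub>L\<^esub> w"
  proof -
    \<comment> \<open>The rescaled derivation has a constant factor, which can be pulled out of its powers.\<close>
    have "s \<otimes> anc y a = q \<otimes> anc x a" if "a \<in> carrier R" for a
      using that s t by (simp add: y_def q(2) anc_smult R.m_assoc)
    then have "((\<lambda>a. s \<otimes> anc y a) ^^ n) s = ((\<lambda>a. q \<otimes> anc x a) ^^ n) s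
        \<and> ((\<lambda>a. q \<otimes> anc x a) ^^ n) s \<in> carrier R" for n
      using s q(1) by (induction n) simp_all
    then have it: "((\<lambda>a. s \<otimes> anc y a) ^^ (p - 1)) s = q [^] (p - 1) \<otimes> D"
      using scaled_anchor_power(1)[OF q(1) s(3,2)] by (simp add: D_def)
    have "q [^] p \<odot>\<^bsub>L\<^esub> P x = P (s \<odot>\<^bsub>L\<^esub> y)"
      using P_const[OF q(1) s(3)] s t by (simp add: y_def q(2) L.smult_assoc1)
    also have "\<dots> = q \<odot>\<^bsub>L\<^esub> P y \<oplus>\<^bsub>L\<^esub> (q [^] (p - 1) \<otimes> D) \<odot>\<^bsub>L\<^esub> y"
      using P_smult_R[OF s(2) y] it by (simp add: q_def)
    also have "(q [^] (p - 1) \<otimes> D) \<odot>\<^bsub>L\<^esub> y = w"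
      using s t D q(1) by (simp add: w_def y_def L.smult_assoc1[symmetric] R.m_ac)
    finally show ?thesis .
  qed
  have den: "q \<otimes> q [^] p = (q [^] (p - 1) \<otimes> t) \<otimes> (s \<otimes> q)"
    using p_power_split[of q] q s t by (simp add: R.m_ac)
  have "lfrac (P x) q = lfrac (q \<odot>\<^bsub>L\<^esub> P y \<oplus>\<^bsub>L\<^esub> w) (q \<otimes> q [^] p)"
    using key lfrac_scale'[of "P x" q "q [^] p"] q(1) s by simp
  also have "\<dots> = lfrac (q \<odot>\<^bsub>L\<^esub> P y) (q \<otimes> q [^] p) \<oplus>\<^bsub>T\<^esub> lfrac w (q \<otimes> q [^] p)"
    using q(1) y w by simp
  also have "lfrac (q \<odot>\<^bsub>L\<^esub> P y) (q \<otimes> q [^] p) = lfrac (P y) (q [^] p)"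
    using lfrac_scale[of "P y" "q [^] p" q] q(1) y by simp
  also have "lfrac w (q \<otimes> q [^] p) = lfrac (D \<odot>\<^bsub>L\<^esub> x) (s \<otimes> q)"
    unfolding den w_def using q(1) s t D by (intro lfrac_scale) simp_all
  finally have eq: "lfrac (P x) q = lfrac (P y) (q [^] p) \<oplus>\<^bsub>T\<^esub> lfrac (D \<odot>\<^bsub>L\<^esub> x) (s \<otimes> q)" .
  have tc: "lfrac (P y) (q [^] p) \<in> carrier T" "lfrac (D \<odot>\<^bsub>L\<^esub> x) (s \<otimes> q) \<in> carrier T"
    using q(1) y s D by simp_all
  have "lfrac (P y) (q [^] p) = lfrac (P x) q \<ominus>\<^bsub>T\<^esub> lfrac (D \<odot>\<^bsub>L\<^esub> x) (s \<otimes> q)"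
    unfolding eq a_minus_def using tc by (simp only: T.a_assoc T.r_neg T.r_zero T.a_inv_closed)
  moreover have "recip R S s [^]\<^bsub>Q\<^esub> p = recip R S q"
    using frac_pow[of \<one> s p] s by (simp add: q_def)
  moreover have "mm (recip R S s [^]\<^bsub>Q\<^esub> (p + 1) \<otimes>\<^bsub>Q\<^esub> embed R S D) x = lfrac (D \<odot>\<^bsub>L\<^esub> x) (s \<otimes> q)"
  proof -
    have "recip R S s [^]\<^bsub>Q\<^esub> (p + 1) = recip R S (s \<otimes> q)"
      using frac_pow[of \<one> s "p + 1"] s by (simp add: q_def R.m_comm)
    then show ?thesis using mm_frac[of D "s \<otimes> q" x] s D q(1) by simp
  qed
  ultimately show ?thesis unfolding lhs D_def by simp
qed

section \<open>The localized algebra is restricted\<close>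

lemma lbr_iterate:
  assumes "c \<in> C" "d \<in> C" "x \<in> carrier L" "y \<in> carrier L"
  shows "(lbr (lfrac x c) ^^ n) (lfrac y d) = lfrac ((br x ^^ n) y) (c [^] n \<otimes> d)
    \<and> (br x ^^ n) y \<in> carrier L"
  using assms by (induction n) (simp_all add: R.m_ac)

lemma lanc_iterate:
  assumes "c \<in> C" "d \<in> C" "x \<in> carrier L" "r \<in> carrier R"
  shows "(lanc (lfrac x c) ^^ n) (frac R S r d) = frac R S ((anc x ^^ n) r) (c [^] n \<otimes> d)
    \<and> (anc x ^^ n) r \<in> carrier R"
  using assms by (induction n) (simp_all add: R.m_ac)

lemma scaled_lanc_iterate:
  assumes "c \<in> C" "d \<in> C" "e \<in> C" "x \<in> carrier L" "r \<in> carrier R" "a \<in> carrier R"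
  shows "((\<lambda>B. frac R S r d \<otimes>\<^bsub>Q\<^esub> lanc (lfrac x c) B) ^^ n) (frac R S a e)
      = frac R S (((\<lambda>b. r \<otimes> anc x b) ^^ n) a) ((d \<otimes> c) [^] n \<otimes> e)
    \<and> ((\<lambda>b. r \<otimes> anc x b) ^^ n) a \<in> carrier R"
  using assms by (induction n) (simp_all add: R.m_ac)

lemma poly_bracket_lfrac:
  assumes "c \<in> C" "d \<in> C" "\<And>n. f n \<in> carrier L" "\<And>n. g n \<in> carrier L"
  shows "poly_bracket (restrict_scalars Q T) lbr (\<lambda>n. lfrac (f n) c) (\<lambda>n. lfrac (g n) d)
    = (\<lambda>n. lfrac (poly_bracket (restrict_scalars R L) br f g n) (c \<otimes> d))"
proof
  fix n
  have gr: "abelian_group (restrict_scalars Q T)" "abelian_group (restrict_scalars R L)"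
    using restrict_scalars_module[OF Q_algebra T_module] Lie.module_axioms
    by (simp_all add: module_def)
  have "poly_bracket (restrict_scalars Q T) lbr (\<lambda>n. lfrac (f n) c) (\<lambda>n. lfrac (g n) d) n
      = (\<Oplus>\<^bsub>restrict_scalars Q T\<^esub>i\<in>{..n}. lfrac (br (f i) (g (n - i))) (c \<otimes> d))"
    unfolding poly_bracket_def using assms by simp
  also have "\<dots> = (\<Oplus>\<^bsub>T\<^esub>i\<in>{..n}. lfrac (br (f i) (g (n - i))) (c \<otimes> d))"
    by (rule restrict_scalars_finsum[OF gr(1) T_abelian]) (use assms in auto)
  also have "\<dots> = lfrac (\<Oplus>\<^bsub>L\<^esub>i\<in>{..n}. br (f i) (g (n - i))) (c \<otimes> d)"
    by (rule lfrac_finsum) (use assms in auto)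
  also have "(\<Oplus>\<^bsub>L\<^esub>i\<in>{..n}. br (f i) (g (n - i)))
      = (\<Oplus>\<^bsub>restrict_scalars R L\<^esub>i\<in>{..n}. br (f i) (g (n - i)))"
    by (rule restrict_scalars_finsum[OF gr(2) L.M.abelian_group_axioms, symmetric])
      (use assms in auto)
  finally show "poly_bracket (restrict_scalars Q T) lbr (\<lambda>n. lfrac (f n) c) (\<lambda>n. lfrac (g n) d) n
      = lfrac (poly_bracket (restrict_scalars R L) br f g n) (c \<otimes> d)"
    unfolding poly_bracket_def .
qed

text \<open>
  \<open>ad(tx/c + y/c)\<close> is \<open>ad(tx + y)\<close> divided by \<open>c\<close>; applied \<open>p - 1\<close> times to \<open>x/c\<close> it produces the
  denominator \<open>c^p\<close>, the same as that of \<open>x^[p] / c^p\<close>.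
\<close>

lemma jacobson_coeff_lfrac:
  assumes "c \<in> C" "x \<in> carrier L" "y \<in> carrier L"
  shows "jacobson_coeff (restrict_scalars Q T) lbr p (lfrac x c) (lfrac y c) n
    = lfrac (jacobson_coeff (restrict_scalars R L) br p x y n) (c [^] p)"
proof -
  define f where "f = (\<lambda>n::nat. if n = 0 then y else if n = 1 then x else \<zero>\<^bsub>L\<^esub>)"
  define g where "g = (\<lambda>n::nat. if n = 0 then x else \<zero>\<^bsub>L\<^esub>)"
  have fg: "f n \<in> carrier L" "g n \<in> carrier L" for n using assms by (simp_all add: f_def g_def)
  have F: "(\<lambda>n. if n = 0 then lfrac y c else if n = 1 then lfrac x c else \<zero>\<^bsub>T\<^esub>) = (\<lambda>n. lfrac (f n) c)"
    and G: "(\<lambda>n. if n = 0 then lfrac x c else \<zero>\<^bsub>T\<^esub>) = (\<lambda>n. lfrac (g n) c)"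
    using assms by (simp_all add: f_def g_def fun_eq_iff)
  let ?F = "poly_bracket (restrict_scalars Q T) lbr (\<lambda>n. lfrac (f n) c)"
  let ?f = "poly_bracket (restrict_scalars R L) br f"
  have cl: "(?f ^^ k) g n \<in> carrier L" for k n
    using Lie.poly_bracket_power_closed[of f g k n] fg by simp
  have "(?F ^^ k) (\<lambda>n. lfrac (g n) c) = (\<lambda>n. lfrac ((?f ^^ k) g n) (c [^] Suc k))" for k
  proof (induction k)
    case (Suc k)
    then show ?case
      using poly_bracket_lfrac[of c "c [^] Suc k" f "(?f ^^ k) g"] assms fg cl
      by (simp add: R.m_ac)
  qed (use assms in simp)
  from fun_cong[OF this[of "p - 1"], of n] show ?thesis
    using prime_gt_0_nat[OF Lie.prime_p]
    unfolding jacobson_coeff_def restrict_scalars_simps F G by (simp add: f_def g_def)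
qed

lemma jacobson_lfrac:
  assumes "c \<in> C" "x \<in> carrier L" "y \<in> carrier L" "0 < i" "i < p"
  shows "jacobson (restrict_scalars Q T) lbr p i (lfrac x c) (lfrac y c)
      = lfrac (jacobson (restrict_scalars R L) br p i x y) (c [^] p)"
    and "jacobson (restrict_scalars R L) br p i x y \<in> carrier L"
proof -
  let ?z = "jacobson (restrict_scalars R L) br p i x y"
  have z: "?z \<in> carrier L" "[i] \<cdot>\<^bsub>L\<^esub> ?z = jacobson_coeff (restrict_scalars R L) br p x y (i - 1)"
    using Lie.jacobson_characterization[OF Lie.char_p Lie.prime_p assms(4,5), of x y ?z] assms(2,3)
    by simp_all
  then have "[i] \<cdot>\<^bsub>T\<^esub> lfrac ?z (c [^] p)
      = jacobson_coeff (restrict_scalars Q T) lbr p (lfrac x c) (lfrac y c) (i - 1)"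
    using jacobson_coeff_lfrac[OF assms(1-3)] lfrac_add_pow[OF z(1)] assms(1) by simp
  then show "jacobson (restrict_scalars Q T) lbr p i (lfrac x c) (lfrac y c) = lfrac ?z (c [^] p)"
    using lie_algebra.jacobson_characterization[OF T_lie_algebra Lie.char_p Lie.prime_p assms(4,5),
        of "lfrac x c" "lfrac y c" "lfrac ?z (c [^] p)"] assms(1-3) z(1)
    by simp
  show "?z \<in> carrier L" by fact
qed

theorem T_restricted:
  assumes P': "\<And>c x. \<lbrakk>c \<in> C; x \<in> carrier L\<rbrakk> \<Longrightarrow> P' (lfrac x c) = lfrac (P x) (c [^] p)"
  shows "restricted_lie_rinehart K Q T lbr lanc p P'"
proof (rule restricted_lie_rinehart.intro[OF T_lie_rinehart])
  show "restricted_lie_algebra K (restrict_scalars Q T) lbr p P'"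
  proof (rule restricted_lie_algebra.intro[OF T_lie_algebra],
      unfold_locales, unfold restrict_scalars_simps, goal_cases)
    case 1
    show ?case by (rule Lie.prime_p)
  next
    case 2
    show ?case by (rule Lie.char_p)
  next
    case (3 X)
    then obtain c x where "c \<in> C" "x \<in> carrier L" "X = lfrac x c" using T_const_cases by metis
    then show ?case by (simp add: P')
  next
    case (4 k X)
    then obtain c x where "c \<in> C" "x \<in> carrier L" "X = lfrac x c" using T_const_cases by metis
    then show ?case using 4(1) Lie.P_smult[of k x] by (simp add: P' scalar_lfrac)
  next
    case (5 X Y)
    obtain c x where X: "c \<in> C" "x \<in> carrier L" "X = lfrac x c" using 5 T_const_cases by metis
    obtain d y where Y: "d \<in> C" "y \<in> carrier L" "Y = lfrac y d" using 5 T_const_cases by metis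
    show ?case using X Y lbr_iterate[of c d x y p] Lie.br_P[of x y] by (simp add: P')
  next
    case (6 X Y)
    obtain c x y where X: "c \<in> C" "x \<in> carrier L" "y \<in> carrier L" "X = lfrac x c" "Y = lfrac y c"
      using 6 T_common_denominator by metis
    let ?j = "\<lambda>i. jacobson (restrict_scalars R L) br p i x y"
    let ?J = "\<lambda>i. jacobson (restrict_scalars Q T) lbr p i X Y"
    have j: "?j i \<in> carrier L" "?J i = lfrac (?j i) (c [^] p)" if "i \<in> {1..p - 1}" for i
      using jacobson_lfrac[of c x y i] X that prime_gt_0_nat[OF Lie.prime_p] by auto
    have gr: "abelian_group (restrict_scalars Q T)" "abelian_group (restrict_scalars R L)"
      using restrict_scalars_module[OF Q_algebra T_module] Lie.module_axioms
      by (simp_all add: module_def)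
    have "(\<Oplus>\<^bsub>restrict_scalars Q T\<^esub>i\<in>{1..p - 1}. ?J i) = (\<Oplus>\<^bsub>T\<^esub>i\<in>{1..p - 1}. ?J i)"
      by (rule restrict_scalars_finsum[OF gr(1) T_abelian]) (use j X in auto)
    also have "\<dots> = (\<Oplus>\<^bsub>T\<^esub>i\<in>{1..p - 1}. lfrac (?j i) (c [^] p))"
      by (rule T.finsum_cong') (use j X in auto)
    also have "\<dots> = lfrac (\<Oplus>\<^bsub>L\<^esub>i\<in>{1..p - 1}. ?j i) (c [^] p)"
      by (rule lfrac_finsum) (use j X in auto)
    also have "(\<Oplus>\<^bsub>L\<^esub>i\<in>{1..p - 1}. ?j i) = (\<Oplus>\<^bsub>restrict_scalars R L\<^esub>i\<in>{1..p - 1}. ?j i)"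
      by (rule restrict_scalars_finsum[OF gr(2) L.M.abelian_group_axioms, symmetric]) (use j in auto)
    finally have J: "(\<Oplus>\<^bsub>restrict_scalars Q T\<^esub>i\<in>{1..p - 1}. ?J i)
      = lfrac (\<Oplus>\<^bsub>restrict_scalars R L\<^esub>i\<in>{1..p - 1}. ?j i) (c [^] p)" .
    have jc: "(\<Oplus>\<^bsub>restrict_scalars R L\<^esub>i\<in>{1..p - 1}. ?j i) \<in> carrier L"
      using Lie.M.finsum_closed[of ?j "{1..p - 1}"] j(1) by auto
    have "P' (X \<oplus>\<^bsub>T\<^esub> Y) = lfrac (P (x \<oplus>\<^bsub>L\<^esub> y)) (c [^] p)" using X by (simp add: P')
    also have "\<dots> = P' X \<oplus>\<^bsub>T\<^esub> P' Y \<oplus>\<^bsub>T\<^esub> lfrac (\<Oplus>\<^bsub>restrict_scalars R L\<^esub>i\<in>{1..p - 1}. ?j i) (c [^] p)"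
      using X jc Lie.P_add[of x y] by (simp add: P')
    finally show ?case unfolding J .
  qed
  show "restricted_lie_rinehart_axioms Q T lanc p P'"
  proof (unfold_locales, goal_cases)
    case (1 X A)
    obtain c x where X: "c \<in> C" "x \<in> carrier L" "X = lfrac x c" using 1 T_const_cases by metis
    obtain d r where A: "d \<in> C" "r \<in> carrier R" "A = frac R S r d" using 1 Q_const_cases by metis
    show ?case using X A lanc_iterate[of c d x r p] by (simp add: P' anc_P)
  next
    case (2 A X)
    obtain c x where X: "c \<in> C" "x \<in> carrier L" "X = lfrac x c" using 2 T_const_cases by metis
    obtain d r where A: "d \<in> C" "r \<in> carrier R" "A = frac R S r d" using 2 Q_const_cases by metis
    let ?w = "((\<lambda>b. r \<otimes> anc x b) ^^ (p - 1)) r"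
    have it: "((\<lambda>B. A \<otimes>\<^bsub>Q\<^esub> lanc X B) ^^ (p - 1)) A = frac R S ?w ((d \<otimes> c) [^] (p - 1) \<otimes> d)"
      and w: "?w \<in> carrier R"
      using scaled_lanc_iterate[of c d d x r r "p - 1"] X A by simp_all
    have den: "(d \<otimes> c) [^] p = (d \<otimes> c) [^] (p - 1) \<otimes> d \<otimes> c"
      using p_power_split[of "d \<otimes> c"] X A by (simp add: R.m_ac)
    have "P' (A \<odot>\<^bsub>T\<^esub> X) = lfrac (r [^] p \<odot>\<^bsub>L\<^esub> P x \<oplus>\<^bsub>L\<^esub> ?w \<odot>\<^bsub>L\<^esub> x) ((d \<otimes> c) [^] p)"
      using X A P_smult_R[of r x] by (simp add: P')
    also have "\<dots> = lfrac (r [^] p \<odot>\<^bsub>L\<^esub> P x) ((d \<otimes> c) [^] p) \<oplus>\<^bsub>T\<^esub> lfrac (?w \<odot>\<^bsub>L\<^esub> x) ((d \<otimes> c) [^] p)"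
      using X A w by simp
    also have "lfrac (r [^] p \<odot>\<^bsub>L\<^esub> P x) ((d \<otimes> c) [^] p) = A [^]\<^bsub>Q\<^esub> p \<odot>\<^bsub>T\<^esub> P' X"
      using X A by (simp add: P' frac_pow R.nat_pow_distrib)
    also have "lfrac (?w \<odot>\<^bsub>L\<^esub> x) ((d \<otimes> c) [^] p) = ((\<lambda>B. A \<otimes>\<^bsub>Q\<^esub> lanc X B) ^^ (p - 1)) A \<odot>\<^bsub>T\<^esub> X"
      unfolding it den using X A w by simp
    finally show ?case .
  qed
qed

lemma lpow_closed: "X \<in> carrier T \<Longrightarrow> lpow X \<in> carrier T"
  using T_const_cases[of X] lpow_const by (metis C_S C_pow P_closed lfrac_closed)

text \<open>
  Every element of the localized module is a fraction, so the formula on fractions leaves only one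
  candidate; existence is \<^term>\<open>lpow\<close>, which is restricted to the carrier because operations are compared as
  extensional functions.
\<close>

lemma power_operation_iff:
  "P' \<in> carrier T \<rightarrow>\<^sub>E carrier T \<and>
    (\<forall>s\<in>S. \<forall>x\<in>carrier L. P' (lfrac x s) = mm (recip R S s [^]\<^bsub>Q\<^esub> p) (P x)
      \<ominus>\<^bsub>T\<^esub> mm (recip R S s [^]\<^bsub>Q\<^esub> (p + 1) \<otimes>\<^bsub>Q\<^esub> embed R S ((anc x ^^ (p - 1)) s)) x)
    \<longleftrightarrow> P' = restrict lpow (carrier T)"
  (is "?PiE \<and> ?formula \<longleftrightarrow> _")
proof -
  have alt: "?formula \<longleftrightarrow> (\<forall>s\<in>S. \<forall>x\<in>carrier L. P' (lfrac x s) = lpow (lfrac x s))"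
    by (intro ball_cong refl) (simp only: lpow_frac)
  have lp: "restrict lpow (carrier T) \<in> carrier T \<rightarrow>\<^sub>E carrier T"
    using lpow_closed by (rule restrict_PiE_iff[THEN iffD2, OF ballI])
  show ?thesis unfolding alt
  proof (intro iffI conjI ballI; (elim conjE)?)
    assume P': "?PiE" "\<forall>s\<in>S. \<forall>x\<in>carrier L. P' (lfrac x s) = lpow (lfrac x s)"
    show "P' = restrict lpow (carrier T)"
    proof (rule PiE_ext[OF P'(1) lp])
      fix X assume X: "X \<in> carrier T"
      obtain s x where sx: "s \<in> S" "x \<in> carrier L" "X = lfrac x s" using X T_cases by metis
      have "P' X = lpow X" unfolding sx(3) using P'(2) sx(1,2) by blast
      also have "\<dots> = restrict lpow (carrier T) X" by (rule restrict_apply'[symmetric]) fact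
      finally show "P' X = restrict lpow (carrier T) X" .
    qed
  next
    assume P': "P' = restrict lpow (carrier T)"
    show "?PiE" unfolding P' by (rule lp)
    show "P' (lfrac x s) = lpow (lfrac x s)" if "s \<in> S" "x \<in> carrier L" for s x
      unfolding P' by (rule restrict_apply', rule lfrac_closed) fact+
  qed
qed

end

section \<open>Localization at a prime ideal\<close>

theorem mainTheorem2:
  fixes K :: "('k, 'c) ring_scheme" and R :: "('k, 'r, 'd) module_scheme"
    and L :: "('r, 'l, 'e) module_scheme" and br :: "'l \<Rightarrow> 'l \<Rightarrow> 'l"
    and anc :: "'l \<Rightarrow> 'r \<Rightarrow> 'r" and p :: nat and P :: "'l \<Rightarrow> 'l" and \<pp> :: "'r set"
  assumes "prime p" and "cring K" and "has_characteristic K p" and "algebra K R"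
    and "restricted_lie_rinehart K R L br anc p P"
    and "primeideal \<pp> R"
  shows
    "let S = carrier R - \<pp>;
         Q = localization R S;
         M = module_localization R S L;
         is_power = (\<lambda>P'. P' \<in> carrier M \<rightarrow>\<^sub>E carrier M \<and>
           (\<forall>s\<in>S. \<forall>x\<in>carrier L.
              P' (mfrac R S L (recip R S s) x) =
                mfrac R S L (recip R S s [^]\<^bsub>Q\<^esub> p) (P x)
                \<ominus>\<^bsub>M\<^esub> mfrac R S L (recip R S s [^]\<^bsub>Q\<^esub> (p + 1) \<otimes>\<^bsub>Q\<^esub> embed R S ((anc x ^^ (p - 1)) s)) x))
     in (\<exists>!P'. is_power P') \<and>
        (\<forall>P'. is_power P' \<longrightarrow>
           restricted_lie_rinehart K Q M
             (local_bracket R S L br anc) (local_anchor R S L anc) p P')"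
proof -
  define S where "S = carrier R - \<pp>"
  interpret A: restricted_lie_rinehart K R L br anc p P by fact
  interpret pr: primeideal \<pp> R by fact
  have "localization_setup_axioms R S"
  proof
    show "S \<subseteq> carrier R" by (auto simp: S_def)
    show "\<one>\<^bsub>R\<^esub> \<in> S" using pr.I_notcarr pr.one_imp_carrier by (auto simp: S_def)
    show "s \<otimes>\<^bsub>R\<^esub> t \<in> S" if "s \<in> S" "t \<in> S" for s t
      using that pr.I_prime[of s t] by (auto simp: S_def)
  qed
  then interpret restricted_localization K R L br anc p P S
    by (intro restricted_localization.intro lie_rinehart_localization.intro
        localization_setup.intro A.restricted_lie_rinehart_axioms A.lie_rinehart_axioms
        A.R.cring_axioms A.L.module_axioms)
  have "restricted_lie_rinehart K Q T lbr lanc p (restrict lpow (carrier T))"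
    by (rule T_restricted) (simp add: lpow_const)
  then show ?thesis
    unfolding Let_def S_def[symmetric] power_operation_iff by simp
qed

end
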